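(* Let $a<b$ be real numbers, let $n\ge 1$, and let $K:[a,b]\times[a,b]\to\mathbb{C}^{n\times n}$ be a continuous matrix function. Suppose that for every $\xi\in(a,b]$ the matrix integral equation $$g(t,\xi)-\int_a^{\xi}K(t,s)\,g(s,\xi)\,ds=I,\qquad a\le t\le\xi,$$ and, therefore, the matrix integral equation $$g^*(t,\xi)-\int_a^{\xi}g^*(s,\xi)\,K(s,t)\,ds=I,\qquad a\le t\le\xi,$$ have unique solutions $g(t,\xi)$ and $g^*(t,\xi)$ respectively, and that $$\det\bigl[g^*(\xi,\xi)\,g(\xi,\xi)\bigr]\ne 0,\qquad a\le\xi\le b .$$ Then for every continuous vector function $f:[a,b]\to\mathbb{C}^n$ the unique solution $\phi$ of the system $$\phi(t)-\int_a^b K(t,s)\,\phi(s)\,ds=f(t),\qquad t\in[a,b],$$ can be found by the formula $$\phi(t)=g(t,b)\,[M'(b)]^{-1}\Bigl[\frac{d}{d\xi}\int_a^{\xi}g^*(s,\xi)f(s)\,ds\Bigr]_{\xi=b}-\int_t^b g(t,\xi)\,\frac{d}{d\xi}\Bigl\{[M'(\xi)]^{-1}\frac{d}{d\xi}\int_a^{\xi}g^*(s,\xi)f(s)\,ds\Bigr\}\,d\xi .$$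
   Context: $I$ is the $n\times n$ identity matrix, and $g(t,\xi)$, $g^*(t,\xi)$ are $n\times n$ matrix functions. The notation $g^*$ is just the name of the solution of the second matrix equation; it does not denote an adjoint or conjugate transpose. At $\xi=a$ the two matrix equations reduce to $g(a,a)=g^*(a,a)=I$. For $\xi\in(a,b]$, $\Gamma_\xi(t,s)$ ($a\le t,s\le\xi$) denotes the resolvent kernel of $K$ on $[a,\xi]$, i.e. the $n\times n$ matrix function determined by the equivalent equations $$\Gamma_\xi(t,s)-\int_a^\xi K(t,u)\Gamma_\xi(u,s)\,du=K(t,s),\qquad \Gamma_\xi(t,s)-\int_a^\xi \Gamma_\xi(t,u)K(u,s)\,du=K(t,s).$$ The matrix function $M$ on $[a,b]$ is defined by $$M(\xi)=(\xi-a)I+\int_a^\xi\int_a^\xi\Gamma_\xi(t,s)\,dt\,ds,$$ and $M'$ is its derivative; it satisfies $M'(\xi)=g^*(\xi,\xi)\,g(\xi,\xi)$.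
   Formalization: For general continuous f the function in braces need not be differentiable (K=0 gives f itself), so the last integral is taken as a Riemann–Stieltjes integral of g(t,ξ) against it; the formula as written is asserted when that function is differentiable on (t,b). *)

theory Defs
  imports "HOL-Analysis.Analysis"
begin

text \<open>
  Kernels and matrix functions are total functions on the reals; only their values at arguments
  in the relevant intervals matter.  Solutions of integral equations are understood to be continuous
  (for a continuous kernel and right-hand side, Lebesgue integrable ones are automatically so).
\<close>

definition unique_solution_on :: "real set \<Rightarrow> ((real \<Rightarrow> 'v) \<Rightarrow> bool) \<Rightarrow> (real \<Rightarrow> 'v) \<Rightarrow> bool" where
  "unique_solution_on S E h \<longleftrightarrow> E h \<and> (\<forall>h'. E h' \<longrightarrow> (\<forall>t\<in>S. h' t = h t))"

definition g_equation ::
  "(real \<Rightarrow> real \<Rightarrow> complex^'n^'n) \<Rightarrow> real \<Rightarrow> real \<Rightarrow> (real \<Rightarrow> complex^'n^'n) \<Rightarrow> bool" where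
  "g_equation K a \<xi> h \<longleftrightarrow> continuous_on {a..\<xi>} h \<and>
     (\<forall>t\<in>{a..\<xi>}. h t - integral {a..\<xi>} (\<lambda>s. K t s ** h s) = mat 1)"

definition g_star_equation ::
  "(real \<Rightarrow> real \<Rightarrow> complex^'n^'n) \<Rightarrow> real \<Rightarrow> real \<Rightarrow> (real \<Rightarrow> complex^'n^'n) \<Rightarrow> bool" where
  "g_star_equation K a \<xi> h \<longleftrightarrow> continuous_on {a..\<xi>} h \<and>
     (\<forall>t\<in>{a..\<xi>}. h t - integral {a..\<xi>} (\<lambda>s. h s ** K s t) = mat 1)"

definition fredholm_equation ::
  "(real \<Rightarrow> real \<Rightarrow> complex^'n^'n) \<Rightarrow> real \<Rightarrow> real \<Rightarrow> (real \<Rightarrow> complex^'n) \<Rightarrow> (real \<Rightarrow> complex^'n) \<Rightarrow> bool" where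
  "fredholm_equation K a b f \<phi> \<longleftrightarrow> continuous_on {a..b} \<phi> \<and>
     (\<forall>t\<in>{a..b}. \<phi> t - integral {a..b} (\<lambda>s. K t s *v \<phi> s) = f t)"

text \<open>
  The functions below are chosen solutions, meaningful where the respective equation is uniquely
  solvable.  For \<open>\<xi> = a\<close> the integrals vanish, so that
  \<open>g_sol K a a a = g_star_sol K a a a = mat 1\<close>.
\<close>

definition g_sol :: "(real \<Rightarrow> real \<Rightarrow> complex^'n^'n) \<Rightarrow> real \<Rightarrow> real \<Rightarrow> real \<Rightarrow> complex^'n^'n" where
  "g_sol K a t \<xi> = (SOME h. g_equation K a \<xi> h) t"

definition g_star_sol :: "(real \<Rightarrow> real \<Rightarrow> complex^'n^'n) \<Rightarrow> real \<Rightarrow> real \<Rightarrow> real \<Rightarrow> complex^'n^'n" where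
  "g_star_sol K a t \<xi> = (SOME h. g_star_equation K a \<xi> h) t"

definition is_resolvent_kernel ::
  "(real \<Rightarrow> real \<Rightarrow> complex^'n^'n) \<Rightarrow> real \<Rightarrow> real \<Rightarrow> (real \<Rightarrow> real \<Rightarrow> complex^'n^'n) \<Rightarrow> bool" where
  "is_resolvent_kernel K a \<xi> \<Gamma> \<longleftrightarrow> continuous_on ({a..\<xi>} \<times> {a..\<xi>}) (\<lambda>(t, s). \<Gamma> t s) \<and>
     (\<forall>t\<in>{a..\<xi>}. \<forall>s\<in>{a..\<xi>}.
        \<Gamma> t s - integral {a..\<xi>} (\<lambda>u. K t u ** \<Gamma> u s) = K t s \<and>
        \<Gamma> t s - integral {a..\<xi>} (\<lambda>u. \<Gamma> t u ** K u s) = K t s)"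

text \<open>
  The two equations determine a resolvent kernel on the square, since \<open>\<Gamma>\<close> is a two-sided
  quasi-inverse of \<open>K\<close>.
\<close>

definition resolvent_kernel ::
  "(real \<Rightarrow> real \<Rightarrow> complex^'n^'n) \<Rightarrow> real \<Rightarrow> real \<Rightarrow> real \<Rightarrow> real \<Rightarrow> complex^'n^'n" where
  "resolvent_kernel K a \<xi> = (SOME \<Gamma>. is_resolvent_kernel K a \<xi> \<Gamma>)"

definition M_fun :: "(real \<Rightarrow> real \<Rightarrow> complex^'n^'n) \<Rightarrow> real \<Rightarrow> real \<Rightarrow> complex^'n^'n" where
  "M_fun K a \<xi> = (\<xi> - a) *\<^sub>R mat 1 +
     integral {a..\<xi>} (\<lambda>s. integral {a..\<xi>} (\<lambda>t. resolvent_kernel K a \<xi> t s))"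

text \<open>Derivatives at the end points of \<open>{a..b}\<close> are one-sided.\<close>

definition M_deriv :: "(real \<Rightarrow> real \<Rightarrow> complex^'n^'n) \<Rightarrow> real \<Rightarrow> real \<Rightarrow> real \<Rightarrow> complex^'n^'n" where
  "M_deriv K a b \<xi> = vector_derivative (M_fun K a) (at \<xi> within {a..b})"

definition g_star_moment ::
  "(real \<Rightarrow> real \<Rightarrow> complex^'n^'n) \<Rightarrow> real \<Rightarrow> (real \<Rightarrow> complex^'n) \<Rightarrow> real \<Rightarrow> complex^'n" where
  "g_star_moment K a f \<xi> = integral {a..\<xi>} (\<lambda>s. g_star_sol K a s \<xi> *v f s)"

text \<open>The expression in braces: \<open>V(\<xi>) = M'(\<xi>)\<^sup>-\<^sup>1 (d/d\<xi>) \<integral>\<^sub>a\<^sup>\<xi> g\<^sup>*(s,\<xi>) f(s) ds\<close>.\<close>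

definition V_fun ::
  "(real \<Rightarrow> real \<Rightarrow> complex^'n^'n) \<Rightarrow> real \<Rightarrow> real \<Rightarrow> (real \<Rightarrow> complex^'n) \<Rightarrow> real \<Rightarrow> complex^'n" where
  "V_fun K a b f \<xi> = matrix_inv (M_deriv K a b \<xi>) *v
     vector_derivative (g_star_moment K a f) (at \<xi> within {a..b})"

text \<open>
  Riemann--Stieltjes integral \<open>\<integral>\<^sub>c\<^sup>d G(\<xi>) dV(\<xi>)\<close> as the limit of Riemann--Stieltjes sums over tagged
  divisions whose mesh tends to \<open>0\<close>.  For merely continuous \<open>f\<close> the function \<open>V\<close> above is continuous
  but may be nowhere differentiable (for \<open>K = 0\<close> it equals \<open>f\<close>), and
  \<open>\<integral> G(\<xi>) (dV/d\<xi>) d\<xi>\<close> has to be read as \<open>\<integral> G(\<xi>) dV(\<xi>)\<close>.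
\<close>

definition has_stieltjes_integral ::
  "(real \<Rightarrow> complex^'n^'n) \<Rightarrow> (real \<Rightarrow> complex^'n) \<Rightarrow> complex^'n \<Rightarrow> real \<Rightarrow> real \<Rightarrow> bool" where
  "has_stieltjes_integral G V I c d \<longleftrightarrow>
     (\<forall>e>0. \<exists>\<delta>>0. \<forall>p. p tagged_division_of {c..d} \<and> (\<lambda>x. ball x \<delta>) fine p \<longrightarrow>
        norm ((\<Sum>(x, k)\<in>p. G x *v (V (Sup k) - V (Inf k))) - I) < e)"

end

theory Submission
  imports Defs "HOL-Complex_Analysis.Great_Picard"
begin

text \<open>
  Let \<open>T\<^sub>\<xi> h(t) = \<integral>\<^sub>a\<^sup>\<xi> K(t,s) h(s) ds\<close>.  By uniqueness, \<open>1 - T\<^sub>\<xi>\<close> is injective for every \<open>\<xi>\<close>; by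
  compactness it is bounded below uniformly in \<open>\<xi>\<close>, so that moving \<open>\<xi>\<close> up from \<open>a\<close> makes every
  \<open>1 - T\<^sub>\<xi>\<close> invertible, with inverse continuous in \<open>\<xi>\<close>.  This yields the resolvent kernel \<open>\<Gamma>\<^sub>\<xi>(t,s)\<close>,
  jointly continuous in \<open>\<xi>, t, s\<close>, and \<open>\<partial>\<^sub>\<xi> \<Gamma>\<^sub>\<xi>(t,s) = \<Gamma>\<^sub>\<xi>(t,\<xi>) \<Gamma>\<^sub>\<xi>(\<xi>,s)\<close>.

  For the solution \<open>\<phi>\<^sub>\<xi> = f + \<Gamma>\<^sub>\<xi> f\<close> on \<open>[a,\<xi>]\<close> it follows that \<open>\<partial>\<^sub>\<xi> \<phi>\<^sub>\<xi>(t) = \<Gamma>\<^sub>\<xi>(t,\<xi>) \<phi>\<^sub>\<xi>(\<xi>)\<close>, in particular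
  \<open>\<partial>\<^sub>\<xi> g(t,\<xi>) = \<Gamma>\<^sub>\<xi>(t,\<xi>) g(\<xi>,\<xi>)\<close>, and that \<open>M'(\<xi>) = g\<^sup>*(\<xi>,\<xi>) g(\<xi>,\<xi>)\<close> and
  \<open>(d/d\<xi>) \<integral>\<^sub>a\<^sup>\<xi> g\<^sup>*(s,\<xi>) f(s) ds = g\<^sup>*(\<xi>,\<xi>) \<phi>\<^sub>\<xi>(\<xi>)\<close>.  Hence \<open>V(\<xi>) = g(\<xi>,\<xi>)\<^sup>-\<^sup>1 \<phi>\<^sub>\<xi>(\<xi>)\<close> satisfies
  \<open>\<partial>\<^sub>\<xi> \<phi>\<^sub>\<xi>(t) = \<partial>\<^sub>\<xi> g(t,\<xi>) V(\<xi>)\<close> and \<open>\<phi>\<^sub>t(t) = g(t,t) V(t)\<close>, and integrating by parts over \<open>[t,b]\<close>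
  gives the formula.
\<close>

section \<open>Integrals with a variable end point\<close>

text \<open>The integral of \<open>h - d\<close> between \<open>x\<close> and \<open>y\<close> is at
  most \<open>e\<close> times the length. A nearby value of the integrand as \<open>d\<close> leads
  to derivatives; \<open>d = 0\<close> gives a Lipschitz bound in the end point.\<close>

lemma norm_integral_increment_le:
  fixes h :: "real \<Rightarrow> 'v::banach"
  assumes "continuous_on {a..b} h" "x \<in> {a..b}" "y \<in> {a..b}"
    and "\<And>s. s \<in> closed_segment x y \<Longrightarrow> norm (h s - d) \<le> e"
  shows "norm (integral {a..y} h - integral {a..x} h - (y - x) *\<^sub>R d) \<le> e * \<bar>y - x\<bar>"
proof -
  \<comment> \<open>The case of increasing end points; exchanging \<open>x\<close> and
    \<open>y\<close> only changes the sign inside the norm.\<close>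
  have *: "norm (integral {a..y} h - integral {a..x} h - (y - x) *\<^sub>R d) \<le> e * (y - x)"
    if "x \<le> y" "x \<in> {a..b}" "y \<in> {a..b}" "\<And>s. s \<in> {x..y} \<Longrightarrow> norm (h s - d) \<le> e" for x y
  proof -
    have c: "continuous_on {x..y} h" "continuous_on {a..y} h"
      using assms(1) that by (auto elim: continuous_on_subset)
    have "integral {a..x} h + integral {x..y} h = integral {a..y} h"
      using that by (intro Henstock_Kurzweil_Integration.integral_combine integrable_continuous_interval c) auto
    moreover have "integral {x..y} (\<lambda>s. h s - d) = integral {x..y} h - (y - x) *\<^sub>R d"
      using that by (subst integral_diff) (auto intro!: integrable_continuous_interval c)
    moreover have "norm (integral {x..y} (\<lambda>s. h s - d)) \<le> e * (y - x)"
      using that by (intro integral_bound continuous_intros c) auto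
    ultimately show ?thesis
      by (metis add_diff_cancel_left')
  qed
  show ?thesis
  proof (cases "x \<le> y")
    case True
    then show ?thesis using *[of x y] assms by (auto simp: closed_segment_eq_real_ivl)
  next
    case False
    then have "norm (integral {a..x} h - integral {a..y} h - (x - y) *\<^sub>R d) \<le> e * (x - y)"
      using *[of y x] assms by (auto simp: closed_segment_eq_real_ivl)
    moreover have "integral {a..x} h - integral {a..y} h - (x - y) *\<^sub>R d
        = - (integral {a..y} h - integral {a..x} h - (y - x) *\<^sub>R d)"
      by (simp add: algebra_simps)
    ultimately show ?thesis using False by (simp only: norm_minus_cancel) simp
  qed
qed

text \<open>By joint continuity \<open>H y s\<close> is close to \<open>H x x\<close> for all
  \<open>s\<close> between \<open>x\<close> and \<open>y\<close>, so only the diagonal value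
  survives. Continuity suffices, so the lemma applies to resolvent kernels before their
  differentiability in the end point is known.\<close>

lemma has_vector_derivative_integral_increment:
  fixes H :: "real \<Rightarrow> real \<Rightarrow> 'v::banach"
  assumes H: "continuous_on ({a..b} \<times> {a..b}) (\<lambda>(\<xi>, s). H \<xi> s)" and x: "x \<in> {a..b}"
  shows "((\<lambda>\<xi>. integral {a..\<xi>} (H \<xi>) - integral {a..x} (H \<xi>)) has_vector_derivative H x x)
           (at x within {a..b})"
  unfolding has_vector_derivative_def has_derivative_within_alt
proof (intro conjI allI impI)
  show "bounded_linear (\<lambda>h. h *\<^sub>R H x x)" by (rule bounded_linear_scaleR_left)
  fix e :: real assume "e > 0"
  have "(x, x) \<in> {a..b} \<times> {a..b}" using x by auto
  then obtain d where d: "d > 0"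
    "\<And>p. p \<in> {a..b} \<times> {a..b} \<Longrightarrow> dist p (x, x) < d \<Longrightarrow> dist (case p of (\<xi>, s) \<Rightarrow> H \<xi> s) (H x x) < e"
    using H \<open>e > 0\<close> unfolding continuous_on_iff by (metis (mono_tags, lifting) case_prod_conv)
  show "\<exists>d>0. \<forall>y\<in>{a..b}. norm (y - x) < d \<longrightarrow>
      norm (integral {a..y} (H y) - integral {a..x} (H y) -
        (integral {a..x} (H x) - integral {a..x} (H x)) - (y - x) *\<^sub>R H x x) \<le> e * norm (y - x)"
  \<comment> \<open>Halving \<open>d\<close> leaves room for both coordinates, since the distance in
    the plane is bounded by the sum of the coordinate distances.\<close>
  proof (intro exI[of _ "d/2"] conjI ballI impI)
    show "d / 2 > 0" using d by simp
    fix y assume y: "y \<in> {a..b}" "norm (y - x) < d / 2"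
    have "continuous_on {a..b} (H y)"
      using y by (intro continuous_on_compose2[OF H, of _ "\<lambda>s. (y, s)", simplified] continuous_intros) auto
    moreover have "norm (H y s - H x x) \<le> e" if "s \<in> closed_segment x y" for s
    proof -
      have s: "s \<in> {a..b}" "\<bar>s - x\<bar> \<le> \<bar>y - x\<bar>"
        using that x y by (auto simp: closed_segment_eq_real_ivl split: if_splits)
      have "dist (y, s) (x, x) \<le> dist y x + dist s x"
        by (simp add: dist_Pair_Pair sqrt_sum_squares_le_sum)
      also have "\<dots> < d" using s y by (simp add: dist_real_def)
      finally have "dist (H y s) (H x x) < e" using d(2)[of "(y, s)"] s y by simp
      then show ?thesis by (simp add: dist_norm)
    qed
    ultimately show "norm (integral {a..y} (H y) - integral {a..x} (H y) -
        (integral {a..x} (H x) - integral {a..x} (H x)) - (y - x) *\<^sub>R H x x) \<le> e * norm (y - x)"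
      using norm_integral_increment_le[of a b "H y" x y "H x x" e] x y by simp
  qed
qed

text \<open>The increment splits into the contribution of the moving end point, treated in the
  previous lemma, and the integral over the fixed interval, where differentiation under the integral
  sign applies.\<close>

lemma leibniz_rule_variable_end:
  fixes H D :: "real \<Rightarrow> real \<Rightarrow> 'v::banach"
  assumes H: "continuous_on ({a..b} \<times> {a..b}) (\<lambda>(\<xi>, s). H \<xi> s)"
    and D: "continuous_on ({a..b} \<times> {a..b}) (\<lambda>(\<xi>, s). D \<xi> s)"
    and d: "\<And>\<xi> s. \<xi> \<in> {a..b} \<Longrightarrow> s \<in> {a..b} \<Longrightarrow>
      ((\<lambda>\<xi>. H \<xi> s) has_vector_derivative D \<xi> s) (at \<xi> within {a..b})"
    and x: "x \<in> {a..b}"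
  shows "((\<lambda>\<xi>. integral {a..\<xi>} (H \<xi>)) has_vector_derivative H x x + integral {a..x} (D x))
           (at x within {a..b})"
proof -
  have "((\<lambda>\<xi>. integral (cbox a x) (H \<xi>)) has_vector_derivative integral (cbox a x) (D x))
           (at x within {a..b})"
  proof (rule leibniz_rule_vector_derivative)
    show "H \<xi> integrable_on cbox a x" if "\<xi> \<in> {a..b}" for \<xi>
      unfolding box_real using x that
      by (intro integrable_continuous_interval
          continuous_on_compose2[OF H, of _ "\<lambda>s. (\<xi>, s)", simplified] continuous_intros) auto
    show "continuous_on ({a..b} \<times> cbox a x) (\<lambda>(\<xi>, s). D \<xi> s)"
      using D by (rule continuous_on_subset) (use x in auto)
  qed (use x d in auto)
  from has_vector_derivative_add[OF has_vector_derivative_integral_increment[OF H x] this]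
  show ?thesis by simp
qed

lemma integral_rescale:
  fixes f :: "real \<Rightarrow> 'v::banach"
  assumes "continuous_on {a..u} f" "a \<le> u"
  shows "integral {a..u} f = (u - a) *\<^sub>R integral {0..1} (\<lambda>s. f (a + s * (u - a)))"
proof (cases "a = u")
  case False
  then have "((\<lambda>x. f ((u - a) *\<^sub>R x + a)) has_integral (1 / \<bar>u - a\<bar> ^ DIM(real)) *\<^sub>R integral {a..u} f)
      ((\<lambda>x. (1 / (u - a)) *\<^sub>R x + - ((1 / (u - a)) *\<^sub>R a)) ` cbox a u)"
    using assms by (intro has_integral_affinity) (auto intro!: integrable_integral integrable_continuous_interval)
  moreover have "(\<lambda>x. (1 / (u - a)) *\<^sub>R x + - ((1 / (u - a)) *\<^sub>R a)) ` cbox a u = {0..1}"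
    using False assms(2) by (subst image_affinity_cbox) (auto simp: diff_divide_distrib[symmetric])
  ultimately have "integral {0..1} (\<lambda>s. f ((u - a) *\<^sub>R s + a)) = (1 / (u - a)) *\<^sub>R integral {a..u} f"
    using False assms(2) by (auto dest!: integral_unique)
  moreover have "(\<lambda>s. f ((u - a) *\<^sub>R s + a)) = (\<lambda>s. f (a + s * (u - a)))"
    by (simp add: algebra_simps)
  ultimately show ?thesis
    using False by simp
qed simp

text \<open>Rescaling to \<open>[0,1]\<close> moves the end point \<open>u x\<close> into the
  integrand, so that continuity of parameter integrals over a fixed interval applies.\<close>

lemma continuous_on_integral_variable_end:
  fixes f :: "'x::topological_space \<Rightarrow> real \<Rightarrow> 'v::banach"
  assumes f: "continuous_on (X \<times> {a..b}) (\<lambda>(x, s). f x s)"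
    and u: "continuous_on X u" "\<And>x. x \<in> X \<Longrightarrow> u x \<in> {a..b}"
  shows "continuous_on X (\<lambda>x. integral {a..u x} (f x))"
proof -
  have "continuous_on X (\<lambda>x. (u x - a) *\<^sub>R integral (cbox 0 1) (\<lambda>s. f x (a + s * (u x - a))))"
  proof (intro continuous_intros u(1) integral_continuous_on_param)
    have m: "a + s * (u x - a) \<in> {a..b}" if "x \<in> X" "s \<in> {0..1}" for x s
    proof -
      have "s * (u x - a) \<le> 1 * (u x - a)" using that u(2)[of x] by (intro mult_right_mono) auto
      then show ?thesis using that u(2)[of x] by auto
    qed
    show "continuous_on (X \<times> cbox 0 1) (\<lambda>(x, s). f x (a + s * (u x - a)))"
      unfolding case_prod_unfold
      using m by (intro continuous_on_compose2[OF f, of _ "\<lambda>p. (fst p, a + snd p * (u (fst p) - a))", simplified]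
          continuous_intros continuous_on_compose2[OF u(1)]) auto
  qed
  moreover have "integral {a..u x} (f x) = (u x - a) *\<^sub>R integral (cbox 0 1) (\<lambda>s. f x (a + s * (u x - a)))"
    if "x \<in> X" for x
  proof -
    have "continuous_on {a..u x} (f x)"
      using u(2) that by (intro continuous_on_compose2[OF f, of _ "\<lambda>s. (x, s)", simplified] continuous_intros) fastforce+
    then show ?thesis using integral_rescale[of a "u x" "f x"] u(2)[OF that] by simp
  qed
  ultimately show ?thesis by (simp cong: continuous_on_cong)
qed

lemma integral_swap_continuous_ivl:
  fixes f :: "real \<Rightarrow> real \<Rightarrow> 'v::banach"
  assumes "continuous_on ({a..b} \<times> {c..d}) (\<lambda>(x, y). f x y)"
  shows "integral {a..b} (\<lambda>x. integral {c..d} (f x)) = integral {c..d} (\<lambda>y. integral {a..b} (\<lambda>x. f x y))"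
  using integral_swap_continuous[of a c b d f] assms by (simp add: cbox_Pair_eq)

section \<open>The resolvent of a Fredholm kernel\<close>

text \<open>Kernel values are kept abstract so that the theory applies to the matrix product and
  also, through \<open>opposite_action\<close>, to the reversed product.\<close>

locale kernel_algebra =
  fixes comp :: "'k \<Rightarrow> 'k \<Rightarrow> 'k::euclidean_space" (infixl "\<bullet>\<^sub>k" 70)
  assumes bounded_bilinear_comp: "bounded_bilinear (\<bullet>\<^sub>k)"
    and comp_assoc: "(x \<bullet>\<^sub>k y) \<bullet>\<^sub>k z = x \<bullet>\<^sub>k (y \<bullet>\<^sub>k z)"
begin

sublocale comp: bounded_bilinear "(\<bullet>\<^sub>k)" by (rule bounded_bilinear_comp)

end

text \<open>
  Clamping the arguments makes the kernel continuous on the whole plane, so that the operators act on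
  the Banach space of bounded continuous functions on the real line.
\<close>

locale kernel_family = kernel_algebra comp
  for comp :: "'k \<Rightarrow> 'k \<Rightarrow> 'k::euclidean_space" (infixl "\<bullet>\<^sub>k" 70) +
  fixes a b :: real and K :: "real \<Rightarrow> real \<Rightarrow> 'k"
  assumes ab: "a < b"
    and K_cont: "continuous_on UNIV (\<lambda>(t, s). K t s)"
    and K_clamp: "K t s = K (max a (min b t)) (max a (min b s))"
    and injective: "\<lbrakk>\<xi> \<in> {a..b}; continuous_on {a..b} h;
      \<And>t. t \<in> {a..b} \<Longrightarrow> h t = integral {a..\<xi>} (\<lambda>s. K t s \<bullet>\<^sub>k h s); t \<in> {a..b}\<rbrakk> \<Longrightarrow> h t = 0"
begin

lemma continuous_on_K [continuous_intros]:
  "continuous_on X f \<Longrightarrow> continuous_on X g \<Longrightarrow> continuous_on X (\<lambda>x. K (f x) (g x))"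
  using continuous_on_compose2[OF K_cont, of X "\<lambda>x. (f x, g x)"] by (auto intro: continuous_on_Pair)

lemma K_bound: obtains B where "B > 0" "\<And>t s. norm (K t s) \<le> B"
proof -
  have "compact ((\<lambda>(t, s). K t s) ` ({a..b} \<times> {a..b}))"
    by (intro compact_continuous_image continuous_on_subset[OF K_cont] compact_Times) auto
  then have "bounded ((\<lambda>(t, s). K t s) ` ({a..b} \<times> {a..b}))" by (rule compact_imp_bounded)
  then obtain B where "B > 0" and B: "\<And>x. x \<in> (\<lambda>(t, s). K t s) ` ({a..b} \<times> {a..b}) \<Longrightarrow> norm x \<le> B"
    unfolding bounded_pos by blast
  have "norm (K t s) \<le> B" for t s
    by (subst K_clamp, rule B) (use ab in \<open>auto intro!: image_eqI[of _ _ "(max a (min b t), max a (min b s))"]\<close>)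
  with \<open>B > 0\<close> that show ?thesis by blast
qed

text \<open>Uniform continuity on the square passes to the whole plane because clamping does not
  increase distances.\<close>

lemma K_uniformly_continuous:
  assumes "e > 0"
  obtains d where "d > 0"
    "\<And>t t' s s'. \<bar>t - t'\<bar> < d \<Longrightarrow> \<bar>s - s'\<bar> < d \<Longrightarrow> norm (K t s - K t' s') < e"
proof -
  have "uniformly_continuous_on ({a..b} \<times> {a..b}) (\<lambda>(t, s). K t s)"
    by (intro compact_uniformly_continuous continuous_on_subset[OF K_cont] compact_Times) auto
  then obtain d where d: "d > 0" "\<And>p q. p \<in> {a..b} \<times> {a..b} \<Longrightarrow> q \<in> {a..b} \<times> {a..b} \<Longrightarrow>
      dist q p < d \<Longrightarrow> dist (case q of (t, s) \<Rightarrow> K t s) (case p of (t, s) \<Rightarrow> K t s) < e"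
    using assms unfolding uniformly_continuous_on_def by metis
  define c where "c t = max a (min b t)" for t
  have c: "c t \<in> {a..b}" "\<bar>c t - c s\<bar> \<le> \<bar>t - s\<bar>" for t s
    using ab by (auto simp: c_def max_def min_def)
  have "norm (K t s - K t' s') < e" if "\<bar>t - t'\<bar> < d / 2" "\<bar>s - s'\<bar> < d / 2" for t t' s s'
  proof -
    have "dist (c t, c s) (c t', c s') \<le> dist (c t) (c t') + dist (c s) (c s')"
      by (simp add: dist_Pair_Pair sqrt_sum_squares_le_sum)
    also have "\<dots> < d" using c(2)[of t t'] c(2)[of s s'] that by (simp add: dist_real_def)
    finally have "dist (K (c t) (c s)) (K (c t') (c s')) < e"
      using d(2)[of "(c t', c s')" "(c t, c s)"] c(1) by simp
    then show ?thesis by (metis K_clamp c_def dist_norm)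
  qed
  with d(1) that[of "d / 2"] show ?thesis by simp
qed

section \<open>The integral operators on bounded continuous functions\<close>

definition T :: "real \<Rightarrow> (real \<Rightarrow>\<^sub>C 'k) \<Rightarrow> (real \<Rightarrow>\<^sub>C 'k)" where
  "T \<xi> h = Bcontfun (\<lambda>t. integral {a..\<xi>} (\<lambda>s. K t s \<bullet>\<^sub>k h s))"

lemma continuous_on_apply_bcontfun' [continuous_intros]:
  "continuous_on X f \<Longrightarrow> continuous_on X (\<lambda>x. apply_bcontfun h (f x))"
  by (rule continuous_on_compose2[OF continuous_on_apply_bcontfun]) auto

lemma T_integrable: "(\<lambda>s. K t s \<bullet>\<^sub>k apply_bcontfun h s) integrable_on {x..y}"
  by (intro integrable_continuous_interval continuous_intros comp.continuous_on)

text \<open>The constant is uniform in \<open>t\<close> and \<open>h\<close>, so the supremum over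
  \<open>t\<close> may be taken: \<open>x = a\<close> then bounds the operator, and general
  \<open>x\<close> makes it Lipschitz in the end point.\<close>

lemma integral_K_bound: obtains B where "B > 0"
  "\<And>x y t h. \<lbrakk>x \<in> {a..b}; y \<in> {a..b}\<rbrakk> \<Longrightarrow>
     norm (integral {a..y} (\<lambda>s. K t s \<bullet>\<^sub>k apply_bcontfun h s) - integral {a..x} (\<lambda>s. K t s \<bullet>\<^sub>k apply_bcontfun h s))
       \<le> B * \<bar>y - x\<bar> * norm h"
proof -
  obtain B where B: "B > 0" "\<And>t s. norm (K t s) \<le> B" by (rule K_bound) (rule that)
  obtain C where C: "C > 0" "\<And>x y. norm (x \<bullet>\<^sub>k y) \<le> norm x * norm y * C"
    using comp.pos_bounded by blast
  have "norm (K t s \<bullet>\<^sub>k apply_bcontfun h s) \<le> B * C * norm h" for t s and h :: "real \<Rightarrow>\<^sub>C 'k"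
  proof -
    have "norm (K t s \<bullet>\<^sub>k apply_bcontfun h s) \<le> norm (K t s) * norm (apply_bcontfun h s) * C" by (rule C)
    also have "\<dots> \<le> B * norm h * C" using B C by (intro mult_mono B norm_bounded) auto
    finally show ?thesis by (simp add: mult_ac)
  qed
  then have "norm (integral {a..y} (\<lambda>s. K t s \<bullet>\<^sub>k apply_bcontfun h s) -
      integral {a..x} (\<lambda>s. K t s \<bullet>\<^sub>k apply_bcontfun h s)) \<le> (B * C) * \<bar>y - x\<bar> * norm h"
    if "x \<in> {a..b}" "y \<in> {a..b}" for x y t and h :: "real \<Rightarrow>\<^sub>C 'k"
    using norm_integral_increment_le[of a b "\<lambda>s. K t s \<bullet>\<^sub>k apply_bcontfun h s" x y 0 "B * C * norm h"] that
    by (simp add: mult_ac continuous_intros comp.continuous_on)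
  moreover have "B * C > 0" using B C by simp
  ultimately show ?thesis using that by blast
qed

lemma T_apply:
  assumes "\<xi> \<in> {a..b}"
  shows "apply_bcontfun (T \<xi> h) = (\<lambda>t. integral {a..\<xi>} (\<lambda>s. K t s \<bullet>\<^sub>k h s))"
proof -
  obtain B where B: "B > 0" "\<And>x y t h. \<lbrakk>x \<in> {a..b}; y \<in> {a..b}\<rbrakk> \<Longrightarrow>
     norm (integral {a..y} (\<lambda>s. K t s \<bullet>\<^sub>k apply_bcontfun h s) - integral {a..x} (\<lambda>s. K t s \<bullet>\<^sub>k apply_bcontfun h s))
       \<le> B * \<bar>y - x\<bar> * norm h" by (rule integral_K_bound) (rule that)
  have "(\<lambda>t. integral {a..\<xi>} (\<lambda>s. K t s \<bullet>\<^sub>k h s)) \<in> bcontfun"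
  proof (rule bcontfun_normI)
    show "continuous_on UNIV (\<lambda>t. integral {a..\<xi>} (\<lambda>s. K t s \<bullet>\<^sub>k h s))"
      using assms unfolding case_prod_unfold
      by (intro continuous_on_integral_variable_end[of _ a b])
         (auto simp: case_prod_unfold intro!: continuous_intros comp.continuous_on)
    show "norm (integral {a..\<xi>} (\<lambda>s. K t s \<bullet>\<^sub>k h s)) \<le> B * \<bar>\<xi> - a\<bar> * norm h" for t
      using B(2)[of a \<xi> t h] assms ab by simp
  qed
  then show ?thesis by (simp add: T_def Bcontfun_inverse)
qed

lemma T_diff: "\<xi> \<in> {a..b} \<Longrightarrow> T \<xi> (h - k) = T \<xi> h - T \<xi> k"
  by (intro bcontfun_eqI) (simp add: T_apply comp.diff_right integral_diff T_integrable)

lemma T_scaleR: "\<xi> \<in> {a..b} \<Longrightarrow> T \<xi> (c *\<^sub>R h) = c *\<^sub>R T \<xi> h"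
  by (intro bcontfun_eqI) (simp add: T_apply comp.scaleR_right)

lemma T_start [simp]: "T a h = 0"
  using ab by (intro bcontfun_eqI) (simp add: T_apply)

lemma T_lipschitz: obtains B where "B > 0"
  "\<And>x y h. \<lbrakk>x \<in> {a..b}; y \<in> {a..b}\<rbrakk> \<Longrightarrow> norm (T y h - T x h) \<le> B * \<bar>y - x\<bar> * norm h"
proof -
  obtain B where B: "B > 0" "\<And>x y t h. \<lbrakk>x \<in> {a..b}; y \<in> {a..b}\<rbrakk> \<Longrightarrow>
     norm (integral {a..y} (\<lambda>s. K t s \<bullet>\<^sub>k apply_bcontfun h s) - integral {a..x} (\<lambda>s. K t s \<bullet>\<^sub>k apply_bcontfun h s))
       \<le> B * \<bar>y - x\<bar> * norm h" by (rule integral_K_bound) (rule that)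
  then have "norm (T y h - T x h) \<le> B * \<bar>y - x\<bar> * norm h" if "x \<in> {a..b}" "y \<in> {a..b}" for x y h
    using that by (intro norm_bound) (simp add: T_apply)
  with B(1) that show ?thesis by blast
qed

text \<open>Reduces questions on the whole line to the compact interval: uniform convergence and
  vanishing on \<open>[a,b]\<close> extend to all arguments.\<close>

lemma T_clamp: "\<xi> \<in> {a..b} \<Longrightarrow> apply_bcontfun (T \<xi> h) t = apply_bcontfun (T \<xi> h) (max a (min b t))"
proof -
  assume \<xi>: "\<xi> \<in> {a..b}"
  have "K t = K (max a (min b t))"
    by (rule ext) (subst (1 2) K_clamp, use ab in \<open>simp add: max_def min_def\<close>)
  then show ?thesis using \<xi> by (simp add: T_apply)
qed

text \<open>Uniform continuity of the kernel gives one modulus for the images of the unit ball under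
  all \<open>T \<xi>\<close> at once, which is what Arzela--Ascoli asks for.\<close>

lemma T_equicontinuous:
  assumes "e > 0"
  obtains d where "d > 0" "\<And>\<xi> h t t'. \<lbrakk>\<xi> \<in> {a..b}; norm h \<le> 1; \<bar>t - t'\<bar> < d\<rbrakk> \<Longrightarrow>
    norm (apply_bcontfun (T \<xi> h) t - apply_bcontfun (T \<xi> h) t') < e"
proof -
  obtain C where C: "C > 0" "\<And>x y. norm (x \<bullet>\<^sub>k y) \<le> norm x * norm y * C"
    using comp.pos_bounded by blast
  \<comment> \<open>The difference will be at most \<open>e' * C * (b - a)\<close>, which this
    choice makes equal to \<open>e / 2\<close>.\<close>
  define e' where "e' = e / 2 / (C * (b - a))"
  have "e' > 0" using assms C ab by (simp add: e'_def)
  then obtain d where d: "d > 0"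
    "\<And>t t' s s'. \<bar>t - t'\<bar> < d \<Longrightarrow> \<bar>s - s'\<bar> < d \<Longrightarrow> norm (K t s - K t' s') < e'"
    by (rule K_uniformly_continuous) (rule that)
  have "norm (apply_bcontfun (T \<xi> h) t - apply_bcontfun (T \<xi> h) t') < e"
    if \<xi>: "\<xi> \<in> {a..b}" and h: "norm h \<le> 1" and t: "\<bar>t - t'\<bar> < d" for \<xi> t t' and h :: "real \<Rightarrow>\<^sub>C 'k"
  proof -
    have diff: "apply_bcontfun (T \<xi> h) t - apply_bcontfun (T \<xi> h) t' =
        integral {a..\<xi>} (\<lambda>s. (K t s - K t' s) \<bullet>\<^sub>k apply_bcontfun h s)"
      using \<xi> by (simp add: T_apply comp.diff_left integral_diff T_integrable)
    have "norm (integral {a..\<xi>} (\<lambda>s. (K t s - K t' s) \<bullet>\<^sub>k apply_bcontfun h s)) \<le> (e' * 1 * C) * (\<xi> - a)"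
    proof (rule integral_bound)
      show "norm ((K t s - K t' s) \<bullet>\<^sub>k apply_bcontfun h s) \<le> e' * 1 * C" for s
      proof -
        have "norm ((K t s - K t' s) \<bullet>\<^sub>k apply_bcontfun h s) \<le> norm (K t s - K t' s) * norm (apply_bcontfun h s) * C"
          by (rule C)
        also have "\<dots> \<le> e' * 1 * C"
          using d(2)[of t t' s s] t d(1) C h \<open>e' > 0\<close> norm_bounded[of h s]
          by (intro mult_mono) auto
        finally show ?thesis .
      qed
    qed (use \<xi> in \<open>auto intro!: continuous_intros comp.continuous_on\<close>)
    moreover have "(e' * 1 * C) * (\<xi> - a) \<le> (e' * 1 * C) * (b - a)"
      using \<xi> \<open>e' > 0\<close> C by (intro mult_left_mono) auto
    moreover have "(e' * 1 * C) * (b - a) < e"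
    proof -
      have "C * (b - a) \<noteq> 0" using C ab by simp
      then have "e' * (C * (b - a)) = e / 2" unfolding e'_def by (rule nonzero_eq_divide_eq[THEN iffD1]) simp
      then have "(e' * 1 * C) * (b - a) = e / 2" by (simp only: mult_1_right mult.assoc)
      then show ?thesis using assms by simp
    qed
    ultimately show ?thesis unfolding diff by linarith
  qed
  with d(1) that show ?thesis by blast
qed

text \<open>The change of the function and the change of the end point are separated. The Lipschitz
  bound controls both, the former with \<open>a\<close> as second end point, where
  \<open>T a\<close> vanishes.\<close>

lemma T_tendsto:
  assumes x: "(x \<longlongrightarrow> \<xi>) F" "\<forall>\<^sub>F i in F. x i \<in> {a..b}" and \<xi>: "\<xi> \<in> {a..b}" and h: "(h \<longlongrightarrow> h0) F"
  shows "((\<lambda>i. T (x i) (h i)) \<longlongrightarrow> T \<xi> h0) F"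
proof -
  obtain B where B: "B > 0"
    "\<And>x y h. \<lbrakk>x \<in> {a..b}; y \<in> {a..b}\<rbrakk> \<Longrightarrow> norm (T y h - T x h) \<le> B * \<bar>y - x\<bar> * norm h"
    by (rule T_lipschitz) (rule that)
  have "\<forall>\<^sub>F i in F. norm (T (x i) (h i) - T \<xi> h0) \<le>
      B * \<bar>x i - a\<bar> * norm (h i - h0) + B * \<bar>x i - \<xi>\<bar> * norm h0"
    using x(2)
  proof eventually_elim
    case (elim i)
    have "norm (T (x i) (h i) - T \<xi> h0) = norm (T (x i) (h i - h0) + (T (x i) h0 - T \<xi> h0))"
      by (simp add: T_diff[OF elim])
    also have "\<dots> \<le> norm (T (x i) (h i - h0)) + norm (T (x i) h0 - T \<xi> h0)"
      by (rule norm_triangle_ineq)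
    also have "\<dots> \<le> B * \<bar>x i - a\<bar> * norm (h i - h0) + B * \<bar>x i - \<xi>\<bar> * norm h0"
    proof (rule add_mono)
      show "norm (T (x i) (h i - h0)) \<le> B * \<bar>x i - a\<bar> * norm (h i - h0)"
        using B(2)[OF _ elim, of a "h i - h0"] ab by simp
      show "norm (T (x i) h0 - T \<xi> h0) \<le> B * \<bar>x i - \<xi>\<bar> * norm h0"
        by (rule B(2)[OF \<xi> elim])
    qed
    finally show ?case .
  qed
  moreover have "((\<lambda>i. B * \<bar>x i - a\<bar> * norm (h i - h0) + B * \<bar>x i - \<xi>\<bar> * norm h0) \<longlongrightarrow>
      B * \<bar>\<xi> - a\<bar> * norm (h0 - h0) + B * \<bar>\<xi> - \<xi>\<bar> * norm h0) F"
    by (intro tendsto_intros x h)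
  ultimately have "((\<lambda>i. T (x i) (h i) - T \<xi> h0) \<longlongrightarrow> 0) F"
    by (intro Lim_null_comparison[of "\<lambda>i. T (x i) (h i) - T \<xi> h0"]) simp_all
  then show ?thesis by (simp add: LIM_zero_iff)
qed

text \<open>By Arzela--Ascoli, a sequence violating the bound for varying end points would
  subconverge to a nonzero solution of a homogeneous equation.\<close>

lemma bounded_below:
  obtains C where "C > 0" "\<And>\<xi> h. \<xi> \<in> {a..b} \<Longrightarrow> norm h \<le> C * norm (h - T \<xi> h)"
proof (rule ccontr)
  note bound = that
  assume contra: "\<not> thesis"
  have "\<exists>\<xi> h. \<xi> \<in> {a..b} \<and> norm h = 1 \<and> norm (h - T \<xi> h) < 1 / real (Suc n)" for n
  proof -
    obtain \<xi> h where \<xi>: "\<xi> \<in> {a..b}" and h: "norm h > real (Suc n) * norm (h - T \<xi> h)"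
      using bound[of "real (Suc n)"] contra by (meson not_less of_nat_0_less_iff zero_less_Suc)
    have "real (Suc n) * norm (h - T \<xi> h) \<ge> 0" by simp
    with h have "norm h > 0" by linarith
    \<comment> \<open>Normalising the violating function gives a unit vector that
      \<open>1 - T \<xi>\<close> sends close to zero.\<close>
    define h' where "h' = (1 / norm h) *\<^sub>R h"
    have "h' - T \<xi> h' = (1 / norm h) *\<^sub>R (h - T \<xi> h)"
      using \<xi> by (simp add: h'_def T_scaleR scaleR_diff_right)
    then have "norm (h' - T \<xi> h') = norm (h - T \<xi> h) / norm h" by simp
    also have "\<dots> < 1 / real (Suc n)" using h \<open>norm h > 0\<close> by (simp add: field_simps)
    finally show ?thesis
      using \<xi> \<open>norm h > 0\<close> by (intro exI[of _ \<xi>] exI[of _ h']) (simp add: h'_def)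
  qed
  then obtain x h where x: "\<And>n. x n \<in> {a..b}" and h: "\<And>n. norm (h n) = 1"
    and small: "\<And>n. norm (h n - T (x n) (h n)) < 1 / real (Suc n)" by metis
  obtain \<xi> r where \<xi>: "\<xi> \<in> {a..b}" and r: "strict_mono r" "(x \<circ> r) \<longlonglongrightarrow> \<xi>"
    using compact_imp_seq_compact[of "{a..b}"] x unfolding seq_compact_def by (metis compact_Icc)
  define F where "F n = apply_bcontfun (T (x (r n)) (h (r n)))" for n
  have F_bound: "norm (F n t) \<le> 2" for n t
  proof -
    have "norm (F n t) \<le> norm (T (x (r n)) (h (r n)))" unfolding F_def by (rule norm_bounded)
    also have "\<dots> \<le> norm (h (r n)) + norm (h (r n) - T (x (r n)) (h (r n)))"
      using norm_triangle_sub[of "T (x (r n)) (h (r n))" "h (r n)"] by (simp add: norm_minus_commute)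
    also have "\<dots> \<le> 1 + 1" using h small[of "r n"] by (smt (verit) divide_le_eq_1 of_nat_0_less_iff of_nat_Suc of_nat_0_le_iff)
    finally show ?thesis by simp
  qed
  have equi: "\<exists>d>0. \<forall>n y. y \<in> {a..b} \<and> norm (t - y) < d \<longrightarrow> norm (F n t - F n y) < e"
    if "e > 0" for t e
  proof -
    obtain d where "d > 0" "\<And>\<xi> h t t'. \<lbrakk>\<xi> \<in> {a..b}; norm h \<le> 1; \<bar>t - t'\<bar> < d\<rbrakk> \<Longrightarrow>
        norm (apply_bcontfun (T \<xi> h) t - apply_bcontfun (T \<xi> h) t') < e"
      using \<open>e > 0\<close> by (rule T_equicontinuous) (rule that)
    then show ?thesis using x h by (auto simp: F_def intro!: exI[of _ d])
  qed
  obtain g and k :: "nat \<Rightarrow> nat" where g: "continuous_on {a..b} g" and k: "strict_mono k"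
    and lim: "\<And>e. 0 < e \<Longrightarrow> \<exists>N. \<forall>n t. n \<ge> N \<and> t \<in> {a..b} \<longrightarrow> norm (F (k n) t - g t) < e"
    by (rule Arzela_Ascoli[of "{a..b}" F 2, OF compact_Icc F_bound equi]) (assumption+, rule that)
  \<comment> \<open>The limit \<open>g\<close> is controlled on \<open>[a,b]\<close> only; composing
    it with the clamp \<open>c\<close> gives a bounded continuous function on the line.\<close>
  define c where "c t = max a (min b t)" for t
  have c: "c t \<in> {a..b}" for t using ab by (auto simp: c_def)
  have "bounded (g ` {a..b})" by (intro compact_imp_bounded compact_continuous_image g) simp
  then have "bounded (range (\<lambda>t. g (c t)))" by (rule bounded_subset) (use c in auto)
  moreover have "continuous_on UNIV (\<lambda>t. g (c t))"
    by (rule continuous_on_compose2[OF g]) (use c in \<open>auto simp: c_def intro!: continuous_intros\<close>)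
  ultimately have "(\<lambda>t. g (c t)) \<in> bcontfun" by (simp add: bcontfun_def)
  then obtain G where "(\<lambda>t. g (c t)) = apply_bcontfun G" by (rule bcontfunE)
  then have G: "apply_bcontfun G t = g (c t)" for t by (rule fun_cong[symmetric])
  define s where "s n = r (k n)" for n
  have s: "filterlim s sequentially sequentially"
    unfolding s_def using filterlim_compose[OF filterlim_subseq[OF r(1)] filterlim_subseq[OF k]] .
  have "(\<lambda>n. T (x (s n)) (h (s n))) \<longlonglongrightarrow> G"
  proof (rule uniform_limit_tendsto_bcontfun, rule uniform_limitI)
    fix e :: real assume "e > 0"
    from lim[OF this] obtain N where N: "\<forall>n t. n \<ge> N \<and> t \<in> {a..b} \<longrightarrow> norm (F (k n) t - g t) < e" ..
    have "dist (apply_bcontfun (T (x (s n)) (h (s n))) t) (apply_bcontfun G t) < e" if "n \<ge> N" for n t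
    proof -
      have "apply_bcontfun (T (x (s n)) (h (s n))) t = F (k n) (c t)"
        unfolding F_def c_def s_def by (rule T_clamp[OF x])
      then show ?thesis using N that c by (simp add: G dist_norm)
    qed
    then show "\<forall>\<^sub>F n in sequentially. \<forall>t\<in>UNIV. dist (apply_bcontfun (T (x (s n)) (h (s n))) t) (apply_bcontfun G t) < e"
      unfolding eventually_sequentially by blast
  qed
  note TG = this
  have diff: "(\<lambda>n. h (s n) - T (x (s n)) (h (s n))) \<longlonglongrightarrow> 0"
  proof (rule Lim_null_comparison)
    show "\<forall>\<^sub>F n in sequentially. norm (h (s n) - T (x (s n)) (h (s n))) \<le> 1 / real (Suc (s n))"
      using small by (simp add: less_imp_le)
    show "(\<lambda>n. 1 / real (Suc (s n))) \<longlonglongrightarrow> 0"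
      using filterlim_compose[OF LIMSEQ_Suc[OF lim_1_over_n] s] by simp
  qed
  \<comment> \<open>Since \<open>h - T h\<close> tends to zero along the subsequence,
    \<open>h\<close> inherits the limit of \<open>T h\<close>. So \<open>G\<close> has norm 1 and
    will turn out to be a fixed point of \<open>T \<xi>\<close>.\<close>
  have hG: "(\<lambda>n. h (s n)) \<longlonglongrightarrow> G"
    using tendsto_add[OF diff TG] by simp
  have "(\<lambda>n. x (s n)) \<longlonglongrightarrow> \<xi>"
    using filterlim_compose[OF r(2) filterlim_subseq[OF k]] by (simp add: s_def o_def)
  then have "(\<lambda>n. T (x (s n)) (h (s n))) \<longlonglongrightarrow> T \<xi> G"
    by (intro T_tendsto \<xi> hG) (use x in auto)
  from LIMSEQ_unique[OF tendsto_diff[OF hG this] diff] have "G = T \<xi> G" by simp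
  have zero: "apply_bcontfun G t = 0" if "t \<in> {a..b}" for t
  proof (rule injective[OF \<xi> _ _ that])
    fix t
    show "apply_bcontfun G t = integral {a..\<xi>} (\<lambda>s. K t s \<bullet>\<^sub>k apply_bcontfun G s)"
      using fun_cong[OF arg_cong[OF \<open>G = T \<xi> G\<close>, of apply_bcontfun], of t] by (simp only: T_apply[OF \<xi>])
  qed simp
  have "G = 0"
  proof (rule bcontfun_eqI)
    fix t show "apply_bcontfun G t = apply_bcontfun 0 t"
      using T_clamp[OF \<xi>, of G t] zero[OF c[of t]] by (simp add: c_def flip: \<open>G = T \<xi> G\<close>)
  qed
  moreover have "norm G = 1"
    using tendsto_norm[OF hG] h by (simp add: LIMSEQ_const_iff)
  ultimately show False by simp
qed

text \<open>The method of continuity: solvability propagates from \<open>\<xi> = a\<close>, where the operator is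
  the identity, in steps of a fixed length.\<close>

lemma solvable: "\<xi> \<in> {a..b} \<Longrightarrow> \<exists>h. h - T \<xi> h = f"
proof -
  obtain C where C: "C > 0" "\<And>\<xi> h. \<xi> \<in> {a..b} \<Longrightarrow> norm h \<le> C * norm (h - T \<xi> h)"
    by (rule bounded_below) (rule that)
  obtain B where B: "B > 0"
    "\<And>x y h. \<lbrakk>x \<in> {a..b}; y \<in> {a..b}\<rbrakk> \<Longrightarrow> norm (T y h - T x h) \<le> B * \<bar>y - x\<bar> * norm h"
    by (rule T_lipschitz) (rule that)
  \<comment> \<open>Chosen to make the map \<open>\<Phi>\<close> below a contraction with factor
    1/2. It does not depend on the position of the step, so finitely many steps reach
    \<open>b\<close>.\<close>
  define \<delta> where "\<delta> = 1 / (2 * B * C)"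
  have \<delta>: "\<delta> > 0" using B C by (simp add: \<delta>_def)
  have step: "\<exists>h. h - T y h = f"
    if x: "x \<in> {a..b}" and y: "y \<in> {a..b}" and near: "\<bar>y - x\<bar> \<le> \<delta>" and sol: "\<And>f. \<exists>h. h - T x h = f" for x y f
  proof -
    obtain R where R: "\<And>f. R f - T x (R f) = f" using sol by metis
    have R_lip: "dist (R f) (R g) \<le> C * dist f g" for f g
    proof -
      have "R f - R g - T x (R f - R g) = (R f - T x (R f)) - (R g - T x (R g))"
        by (simp add: T_diff[OF x])
      then have "R f - R g - T x (R f - R g) = f - g" by (simp only: R)
      then show ?thesis using C(2)[OF x, of "R f - R g"] by (simp add: dist_norm)
    qed
    \<comment> \<open>The equation \<open>h - T y h = f\<close> is rewritten as
      \<open>h - T x h = f + (T y h - T x h)\<close>; its solutions are the fixed points of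
      \<open>\<Phi>\<close>.\<close>
    define \<Phi> where "\<Phi> h = R (f + (T y h - T x h))" for h
    have "dist (\<Phi> h) (\<Phi> k) \<le> 1 / 2 * dist h k" for h k
    proof -
      have "(f + (T y h - T x h)) - (f + (T y k - T x k)) = T y (h - k) - T x (h - k)"
        unfolding T_diff[OF x] T_diff[OF y] by (simp add: algebra_simps)
      then have "dist (\<Phi> h) (\<Phi> k) \<le> C * norm (T y (h - k) - T x (h - k))"
        using R_lip[of "f + (T y h - T x h)" "f + (T y k - T x k)"] unfolding \<Phi>_def dist_norm by metis
      also have "\<dots> \<le> C * (B * \<bar>y - x\<bar> * norm (h - k))"
        using B x y C by (intro mult_left_mono) auto
      also have "\<dots> \<le> C * (B * \<delta> * norm (h - k))"
        using B C near by (intro mult_left_mono mult_right_mono) auto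
      also have "\<dots> = 1 / 2 * dist h k" using B C by (simp add: \<delta>_def dist_norm)
      finally show ?thesis .
    qed
    then have "\<exists>!h. \<Phi> h = h"
      by (intro banach_fix_type[of "1/2"]) auto
    then obtain h where "\<Phi> h = h" by blast
    then have "h - T x h = f + (T y h - T x h)" using R[of "f + (T y h - T x h)"] by (simp add: \<Phi>_def)
    then show ?thesis by (intro exI[of _ h]) (simp add: algebra_simps)
  qed
  have reach: "\<forall>\<xi>\<in>{a..b}. \<xi> \<le> a + real n * \<delta> \<longrightarrow> (\<forall>f. \<exists>h. h - T \<xi> h = f)" for n
  proof (induction n)
    case 0
    have "\<exists>h. h - T a h = f" for f by (intro exI[of _ f]) simp
    then show ?case by (auto dest: order.antisym)
  next
    case (Suc n)
    show ?case
    proof (intro ballI impI allI)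
      fix \<xi> f assume \<xi>: "\<xi> \<in> {a..b}" "\<xi> \<le> a + real (Suc n) * \<delta>"
      show "\<exists>h. h - T \<xi> h = f"
      proof (cases "\<xi> \<le> a + real n * \<delta>")
        case True
        then show ?thesis using Suc \<xi> by blast
      next
        case False
        have "0 \<le> real n * \<delta>" using \<delta> by simp
        then show ?thesis
          using Suc \<xi> False by (intro step[of "a + real n * \<delta>" \<xi>]) (auto simp: algebra_simps)
      qed
    qed
  qed
  assume "\<xi> \<in> {a..b}"
  obtain n where "(b - a) / \<delta> \<le> real n" using real_arch_simple by blast
  then have "\<xi> \<le> a + real n * \<delta>" using \<delta> \<open>\<xi> \<in> {a..b}\<close> by (simp add: field_simps)
  then show ?thesis using reach \<open>\<xi> \<in> {a..b}\<close> by blast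
qed

section \<open>The resolvent operator and the resolvent kernel\<close>

definition R :: "real \<Rightarrow> (real \<Rightarrow>\<^sub>C 'k) \<Rightarrow> (real \<Rightarrow>\<^sub>C 'k)" where
  "R \<xi> f = (SOME h. h - T \<xi> h = f)"

lemma R_eq: "\<xi> \<in> {a..b} \<Longrightarrow> R \<xi> f - T \<xi> (R \<xi> f) = f"
  unfolding R_def using someI_ex[OF solvable] .

text \<open>The uniform lower bound estimates the error by the residual \<open>r i\<close> that the
  limiting solution leaves in the equation with end point \<open>x i\<close>, and this residual
  tends to zero.\<close>

lemma R_tendsto:
  assumes x: "(x \<longlongrightarrow> \<xi>) F" "\<forall>\<^sub>F i in F. x i \<in> {a..b}" and \<xi>: "\<xi> \<in> {a..b}" and f: "(f \<longlongrightarrow> f0) F"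
  shows "((\<lambda>i. R (x i) (f i)) \<longlongrightarrow> R \<xi> f0) F"
proof -
  obtain C where C: "C > 0" "\<And>\<xi> h. \<xi> \<in> {a..b} \<Longrightarrow> norm h \<le> C * norm (h - T \<xi> h)"
    by (rule bounded_below) (rule that)
  define r where "r i = (f i - f0) + (T (x i) (R \<xi> f0) - T \<xi> (R \<xi> f0))" for i
  have le: "\<forall>\<^sub>F i in F. norm (R (x i) (f i) - R \<xi> f0) \<le> C * norm (r i)"
    using x(2)
  proof eventually_elim
    case (elim i)
    have "R (x i) (f i) - R \<xi> f0 - T (x i) (R (x i) (f i) - R \<xi> f0) = r i"
      using R_eq[OF elim, of "f i"] R_eq[OF \<xi>, of f0] by (simp add: r_def T_diff[OF elim] algebra_simps)
    then show ?case using C(2)[OF elim, of "R (x i) (f i) - R \<xi> f0"] by simp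
  qed
  have "(r \<longlongrightarrow> (f0 - f0) + (T \<xi> (R \<xi> f0) - T \<xi> (R \<xi> f0))) F"
    unfolding r_def by (intro tendsto_intros f T_tendsto x \<xi>)
  then have "((\<lambda>i. C * norm (r i)) \<longlongrightarrow> C * norm (0 :: real \<Rightarrow>\<^sub>C 'k)) F"
    by (intro tendsto_intros) simp
  then have "((\<lambda>i. C * norm (r i)) \<longlongrightarrow> 0) F" by simp
  from Lim_null_comparison[OF le this] show ?thesis by (rule LIM_zero_cancel)
qed

definition K_col :: "real \<Rightarrow> (real \<Rightarrow>\<^sub>C 'k)" where
  "K_col s = Bcontfun (\<lambda>t. K t s)"

lemma apply_K_col: "apply_bcontfun (K_col s) t = K t s"
proof -
  obtain B where "\<And>t s. norm (K t s) \<le> B" by (rule K_bound) (rule that)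
  then have "(\<lambda>t. K t s) \<in> bcontfun" by (intro bcontfun_normI[of _ B] continuous_intros)
  then show ?thesis by (simp add: K_col_def Bcontfun_inverse)
qed

lemma K_col_tendsto:
  assumes "(s \<longlongrightarrow> s0) F"
  shows "((\<lambda>i. K_col (s i)) \<longlongrightarrow> K_col s0) F"
proof (rule uniform_limit_tendsto_bcontfun, rule uniform_limitI)
  fix e :: real assume "e > 0"
  then obtain d where d: "d > 0"
    "\<And>t t' s s'. \<bar>t - t'\<bar> < d \<Longrightarrow> \<bar>s - s'\<bar> < d \<Longrightarrow> norm (K t s - K t' s') < e"
    by (rule K_uniformly_continuous) (rule that)
  from tendstoD[OF assms d(1)]
  show "\<forall>\<^sub>F i in F. \<forall>t\<in>UNIV. dist (apply_bcontfun (K_col (s i)) t) (apply_bcontfun (K_col s0) t) < e"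
    by eventually_elim (use d in \<open>auto simp: apply_K_col dist_norm\<close>)
qed

text \<open>Built column by column: column \<open>s\<close> solves the equation with column
  \<open>s\<close> of the kernel on the right. The left resolvent equation holds by construction,
  the right one has to be derived in \<open>\<Gamma>_right\<close>.\<close>

definition \<Gamma> :: "real \<Rightarrow> real \<Rightarrow> real \<Rightarrow> 'k" where
  "\<Gamma> \<xi> t s = apply_bcontfun (R \<xi> (K_col s)) t"

lemma \<Gamma>_left:
  assumes "\<xi> \<in> {a..b}"
  shows "\<Gamma> \<xi> t s - integral {a..\<xi>} (\<lambda>u. K t u \<bullet>\<^sub>k \<Gamma> \<xi> u s) = K t s"
  using arg_cong[OF R_eq[OF assms, of "K_col s"], of "\<lambda>h. apply_bcontfun h t"] assms
  by (simp add: T_apply \<Gamma>_def apply_K_col)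

lemma tendsto_apply_bcontfun:
  fixes h :: "'i \<Rightarrow> real \<Rightarrow>\<^sub>C 'k"
  assumes h: "(h \<longlongrightarrow> h0) F" and t: "(t \<longlongrightarrow> t0) F"
  shows "((\<lambda>i. apply_bcontfun (h i) (t i)) \<longlongrightarrow> apply_bcontfun h0 t0) F"
proof -
  have "((\<lambda>i. apply_bcontfun (h i - h0) (t i)) \<longlongrightarrow> 0) F"
  proof (rule Lim_null_comparison)
    show "\<forall>\<^sub>F i in F. norm (apply_bcontfun (h i - h0) (t i)) \<le> norm (h i - h0)"
      by (intro always_eventually allI norm_bounded)
    show "((\<lambda>i. norm (h i - h0)) \<longlongrightarrow> 0) F" using h by (intro tendsto_norm_zero) (simp add: LIM_zero_iff)
  qed
  moreover have "((\<lambda>i. apply_bcontfun h0 (t i)) \<longlongrightarrow> apply_bcontfun h0 t0) F"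
    by (rule continuous_on_tendsto_compose[OF continuous_on_apply_bcontfun[of UNIV] t]) auto
  ultimately show ?thesis using tendsto_add by fastforce
qed

text \<open>Three limits are composed: of the kernel columns, of the resolvent operators applied to
  them, and of the evaluation at a moving point.\<close>

lemma continuous_on_\<Gamma> [continuous_intros]:
  assumes "continuous_on X x" "continuous_on X t" "continuous_on X s" "\<And>p. p \<in> X \<Longrightarrow> x p \<in> {a..b}"
  shows "continuous_on X (\<lambda>p. \<Gamma> (x p) (t p) (s p))"
  unfolding continuous_on_def \<Gamma>_def
proof
  fix p assume "p \<in> X"
  then show "((\<lambda>p. apply_bcontfun (R (x p) (K_col (s p))) (t p)) \<longlongrightarrow>
      apply_bcontfun (R (x p) (K_col (s p))) (t p)) (at p within X)"
    using assms unfolding continuous_on_def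
    by (intro tendsto_apply_bcontfun R_tendsto K_col_tendsto) (auto simp: eventually_at_topological)
qed

end

section \<open>Kernels acting on vectors and quasi-inverses\<close>

lemma (in bounded_bilinear) integral_prod_right:
  "f integrable_on S \<Longrightarrow> prod x (integral S f) = integral S (\<lambda>s. prod x (f s))"
  using integral_linear[OF _ bounded_linear_right[of x], of f S] by (simp add: o_def)

lemma (in bounded_bilinear) integral_prod_left:
  "f integrable_on S \<Longrightarrow> prod (integral S f) x = integral S (\<lambda>s. prod (f s) x)"
  using integral_linear[OF _ bounded_linear_left[of x], of f S] by (simp add: o_def)

text \<open>The type \<open>'v\<close> will stand for vectors in the equation for
  \<open>\<phi>\<close> and for matrices in the equation for \<open>g\<close>, so that both are
  treated at once.\<close>

locale kernel_action = kernel_algebra comp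
  for comp :: "'k \<Rightarrow> 'k \<Rightarrow> 'k::euclidean_space" (infixl "\<bullet>\<^sub>k" 70) +
  fixes act :: "'k \<Rightarrow> 'v \<Rightarrow> 'v::euclidean_space" (infixr "\<bullet>\<^sub>v" 70)
  assumes bounded_bilinear_act: "bounded_bilinear (\<bullet>\<^sub>v)"
    and act_assoc: "(x \<bullet>\<^sub>k y) \<bullet>\<^sub>v v = x \<bullet>\<^sub>v y \<bullet>\<^sub>v v"
begin

sublocale act: bounded_bilinear "(\<bullet>\<^sub>v)" by (rule bounded_bilinear_act)

text \<open>Associativity of the composition of integral operators: Fubini, then
  \<open>act_assoc\<close> under the integral. The two intervals may differ, so that resolvents with
  different end points can be composed.\<close>

lemma integral_act_swap:
  fixes a b c d :: real
  assumes x: "continuous_on {a..b} x" and B: "continuous_on ({a..b} \<times> {c..d}) (\<lambda>(u, s). B u s)"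
    and \<phi>: "continuous_on {c..d} \<phi>"
  shows "integral {a..b} (\<lambda>u. x u \<bullet>\<^sub>v integral {c..d} (\<lambda>s. B u s \<bullet>\<^sub>v \<phi> s)) =
         integral {c..d} (\<lambda>s. integral {a..b} (\<lambda>u. x u \<bullet>\<^sub>k B u s) \<bullet>\<^sub>v \<phi> s)"
proof -
  have B2: "continuous_on {c..d} (B u)" if "u \<in> {a..b}" for u
    using that by (intro continuous_on_compose2[OF B, of _ "\<lambda>s. (u, s)", simplified] continuous_intros) auto
  have B1: "continuous_on {a..b} (\<lambda>u. B u s)" if "s \<in> {c..d}" for s
    using that by (intro continuous_on_compose2[OF B, of _ "\<lambda>u. (u, s)", simplified] continuous_intros) auto
  have "integral {a..b} (\<lambda>u. x u \<bullet>\<^sub>v integral {c..d} (\<lambda>s. B u s \<bullet>\<^sub>v \<phi> s)) =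
        integral {a..b} (\<lambda>u. integral {c..d} (\<lambda>s. x u \<bullet>\<^sub>v B u s \<bullet>\<^sub>v \<phi> s))"
    by (auto intro!: integral_cong act.integral_prod_right integrable_continuous_interval act.continuous_on B2 \<phi>)
  also have "\<dots> = integral {c..d} (\<lambda>s. integral {a..b} (\<lambda>u. x u \<bullet>\<^sub>v B u s \<bullet>\<^sub>v \<phi> s))"
    unfolding case_prod_unfold
    by (intro integral_swap_continuous_ivl)
      (auto simp: case_prod_unfold intro!: act.continuous_on continuous_on_compose2[OF x] continuous_on_compose2[OF \<phi>]
        continuous_on_compose2[OF B, of _ "\<lambda>p. p", unfolded case_prod_unfold] continuous_intros)
  also have "\<dots> = integral {c..d} (\<lambda>s. integral {a..b} (\<lambda>u. x u \<bullet>\<^sub>k B u s) \<bullet>\<^sub>v \<phi> s)"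
  proof (intro integral_cong)
    fix s assume "s \<in> {c..d}"
    then show "integral {a..b} (\<lambda>u. x u \<bullet>\<^sub>v B u s \<bullet>\<^sub>v \<phi> s) = integral {a..b} (\<lambda>u. x u \<bullet>\<^sub>k B u s) \<bullet>\<^sub>v \<phi> s"
      by (subst act.integral_prod_left)
        (auto simp: act_assoc intro!: integrable_continuous_interval comp.continuous_on B1 x)
  qed
  finally show ?thesis .
qed

text \<open>In operator form \<open>AB\<close> says \<open>(1 + A)(1 - B) = 1\<close>, so applying
  \<open>1 + A\<close> to \<open>(1 - B) \<phi> = f\<close> recovers \<open>\<phi>\<close>.
  Different choices of \<open>A\<close> and \<open>B\<close> give both existence and uniqueness
  below.\<close>

lemma quasi_inverse_solution:
  fixes a b :: real
  assumes A: "continuous_on ({a..b} \<times> {a..b}) (\<lambda>(t, s). A t s)"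
    and B: "continuous_on ({a..b} \<times> {a..b}) (\<lambda>(t, s). B t s)"
    and AB: "\<And>t s. t \<in> {a..b} \<Longrightarrow> s \<in> {a..b} \<Longrightarrow> A t s - integral {a..b} (\<lambda>u. A t u \<bullet>\<^sub>k B u s) = B t s"
    and \<phi>: "continuous_on {a..b} \<phi>"
    and f: "\<And>t. t \<in> {a..b} \<Longrightarrow> \<phi> t - integral {a..b} (\<lambda>s. B t s \<bullet>\<^sub>v \<phi> s) = f t"
    and t: "t \<in> {a..b}"
  shows "\<phi> t = f t + integral {a..b} (\<lambda>s. A t s \<bullet>\<^sub>v f s)"
proof -
  have cA: "continuous_on {a..b} (A t)"
    using t by (intro continuous_on_compose2[OF A, of _ "\<lambda>s. (t, s)", simplified] continuous_intros) auto
  have cB: "continuous_on {a..b} (B t)"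
    using t by (intro continuous_on_compose2[OF B, of _ "\<lambda>s. (t, s)", simplified] continuous_intros) auto
  have cB\<phi>: "continuous_on {a..b} (\<lambda>u. integral {a..b} (\<lambda>s. B u s \<bullet>\<^sub>v \<phi> s))"
    using B
    by (intro integral_continuous_on_param[of _ a b "\<lambda>u s. B u s \<bullet>\<^sub>v \<phi> s", unfolded box_real])
      (auto simp: case_prod_unfold intro!: act.continuous_on continuous_on_compose2[OF \<phi>] continuous_intros)
  have "integral {a..b} (\<lambda>s. A t s \<bullet>\<^sub>v f s) =
      integral {a..b} (\<lambda>s. A t s \<bullet>\<^sub>v \<phi> s - A t s \<bullet>\<^sub>v integral {a..b} (\<lambda>u. B s u \<bullet>\<^sub>v \<phi> u))"
    by (intro integral_cong) (simp flip: f add: act.diff_right)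
  also have "\<dots> = integral {a..b} (\<lambda>s. A t s \<bullet>\<^sub>v \<phi> s) -
      integral {a..b} (\<lambda>s. A t s \<bullet>\<^sub>v integral {a..b} (\<lambda>u. B s u \<bullet>\<^sub>v \<phi> u))"
    by (intro integral_diff integrable_continuous_interval act.continuous_on cA \<phi> cB\<phi>)
  also have "integral {a..b} (\<lambda>s. A t s \<bullet>\<^sub>v integral {a..b} (\<lambda>u. B s u \<bullet>\<^sub>v \<phi> u)) =
      integral {a..b} (\<lambda>u. integral {a..b} (\<lambda>s. A t s \<bullet>\<^sub>k B s u) \<bullet>\<^sub>v \<phi> u)"
    by (rule integral_act_swap[OF cA B \<phi>])
  also have "\<dots> = integral {a..b} (\<lambda>u. A t u \<bullet>\<^sub>v \<phi> u - B t u \<bullet>\<^sub>v \<phi> u)"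
    using AB[OF t] by (intro integral_cong) (simp flip: act.diff_left add: algebra_simps)
  also have "\<dots> = integral {a..b} (\<lambda>u. A t u \<bullet>\<^sub>v \<phi> u) - integral {a..b} (\<lambda>u. B t u \<bullet>\<^sub>v \<phi> u)"
    by (intro integral_diff integrable_continuous_interval act.continuous_on cA cB \<phi>)
  finally show ?thesis using f[OF t] by (simp add: algebra_simps)
qed

end

text \<open>Left multiplication makes the algebra act on itself, so the action lemmas also cover
  compositions of kernels.\<close>

sublocale kernel_algebra \<subseteq> regular: kernel_action comp comp
  by unfold_locales (rule bounded_bilinear_comp comp_assoc)+

section \<open>Resolvent identities and the derivative of the resolvent kernel\<close>

context kernel_family
begin

text \<open>The operator identity \<open>(1 - K) \<Gamma> = K\<close>, applied to \<open>p\<close>.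
  The range \<open>\<eta>\<close> of \<open>p\<close> is kept apart from \<open>\<xi>\<close> for
  the comparison of two resolvents in \<open>\<Gamma>_diff\<close>.\<close>

lemma resolvent_integral_equation:
  assumes \<xi>: "\<xi> \<in> {a..b}" and \<eta>: "\<eta> \<in> {a..b}" and p: "continuous_on {a..\<eta>} p"
  defines "q \<equiv> \<lambda>t. integral {a..\<eta>} (\<lambda>u. \<Gamma> \<xi> t u \<bullet>\<^sub>k p u)"
  shows "q t - integral {a..\<xi>} (\<lambda>s. K t s \<bullet>\<^sub>k q s) = integral {a..\<eta>} (\<lambda>u. K t u \<bullet>\<^sub>k p u)"
proof -
  have "integral {a..\<xi>} (\<lambda>s. K t s \<bullet>\<^sub>k q s) =
      integral {a..\<eta>} (\<lambda>u. integral {a..\<xi>} (\<lambda>s. K t s \<bullet>\<^sub>k \<Gamma> \<xi> s u) \<bullet>\<^sub>k p u)"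
    unfolding q_def using \<xi>
    by (intro regular.integral_act_swap p) (auto simp: case_prod_unfold intro!: continuous_intros)
  also have "\<dots> = integral {a..\<eta>} (\<lambda>u. \<Gamma> \<xi> t u \<bullet>\<^sub>k p u - K t u \<bullet>\<^sub>k p u)"
    using \<Gamma>_left[OF \<xi>, of t] by (intro integral_cong) (simp flip: comp.diff_left add: algebra_simps)
  also have "\<dots> = q t - integral {a..\<eta>} (\<lambda>u. K t u \<bullet>\<^sub>k p u)"
    unfolding q_def using \<xi>
    by (intro integral_diff integrable_continuous_interval comp.continuous_on p continuous_intros)
  finally show ?thesis by simp
qed

lemma continuous_on_resolvent_integral:
  assumes \<xi>: "\<xi> \<in> {a..b}" and \<eta>: "\<eta> \<in> {a..b}" and p: "continuous_on {a..\<eta>} p"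
  shows "continuous_on X (\<lambda>t. integral {a..\<eta>} (\<lambda>u. \<Gamma> \<xi> t u \<bullet>\<^sub>k p u))"
  using \<xi> \<eta>
  by (intro integral_continuous_on_param[of X a \<eta> "\<lambda>t u. \<Gamma> \<xi> t u \<bullet>\<^sub>k p u", unfolded box_real])
    (auto simp: case_prod_unfold intro!: comp.continuous_on continuous_on_compose2[OF p] continuous_intros)

lemma integral_K_diff:
  assumes "continuous_on {a..\<xi>} p" "continuous_on {a..\<xi>} q"
  shows "integral {a..\<xi>} (\<lambda>u. K t u \<bullet>\<^sub>k (p u - q u)) =
    integral {a..\<xi>} (\<lambda>u. K t u \<bullet>\<^sub>k p u) - integral {a..\<xi>} (\<lambda>u. K t u \<bullet>\<^sub>k q u)"
  unfolding comp.diff_right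
  by (intro integral_diff integrable_continuous_interval comp.continuous_on continuous_intros assms)

text \<open>Both \<open>\<Gamma> K\<close> and \<open>\<Gamma> - K\<close> are mapped by
  \<open>1 - K\<close> to \<open>K K\<close>, as operators on \<open>[a,\<xi>]\<close>; injectivity
  identifies them.\<close>

lemma \<Gamma>_right:
  assumes \<xi>: "\<xi> \<in> {a..b}" and t: "t \<in> {a..b}"
  shows "\<Gamma> \<xi> t s - integral {a..\<xi>} (\<lambda>u. \<Gamma> \<xi> t u \<bullet>\<^sub>k K u s) = K t s"
proof -
  define q where "q t = integral {a..\<xi>} (\<lambda>u. \<Gamma> \<xi> t u \<bullet>\<^sub>k K u s)" for t
  have cK: "continuous_on X (\<lambda>u. K u s)" for X by (intro continuous_intros)
  have cq: "continuous_on X q" for X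
    unfolding q_def by (rule continuous_on_resolvent_integral[OF \<xi> \<xi> cK])
  have q: "q t - integral {a..\<xi>} (\<lambda>u. K t u \<bullet>\<^sub>k q u) = integral {a..\<xi>} (\<lambda>u. K t u \<bullet>\<^sub>k K u s)" for t
    unfolding q_def by (rule resolvent_integral_equation[OF \<xi> \<xi> cK])
  have "q t - (\<Gamma> \<xi> t s - K t s) = 0"
  proof (rule injective[OF \<xi> _ _ t, where h = "\<lambda>t. q t - (\<Gamma> \<xi> t s - K t s)"])
    show "continuous_on {a..b} (\<lambda>t. q t - (\<Gamma> \<xi> t s - K t s))" using \<xi> by (intro continuous_intros cq)
    fix t
    have "integral {a..\<xi>} (\<lambda>u. K t u \<bullet>\<^sub>k (q u - (\<Gamma> \<xi> u s - K u s))) =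
        integral {a..\<xi>} (\<lambda>u. K t u \<bullet>\<^sub>k q u) - (integral {a..\<xi>} (\<lambda>u. K t u \<bullet>\<^sub>k \<Gamma> \<xi> u s) -
          integral {a..\<xi>} (\<lambda>u. K t u \<bullet>\<^sub>k K u s))"
      using \<xi> by (simp add: integral_K_diff cq cK continuous_on_diff continuous_on_\<Gamma>)
    then show "q t - (\<Gamma> \<xi> t s - K t s) = integral {a..\<xi>} (\<lambda>u. K t u \<bullet>\<^sub>k (q u - (\<Gamma> \<xi> u s - K u s)))"
      using \<Gamma>_left[OF \<xi>, of t s] q[of t] by (simp add: algebra_simps)
  qed
  then show ?thesis by (simp add: q_def algebra_simps)
qed

text \<open>The resolvent identity. Under \<open>1 - T \<xi>\<close> both sides become the
  difference of the integrals of \<open>K t u \<bullet>\<^sub>k \<Gamma> \<eta> u s\<close> up to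
  \<open>\<eta>\<close> and up to \<open>\<xi>\<close>, and injectivity concludes. A difference of
  integrals serves both orders of \<open>\<xi>\<close> and \<open>\<eta>\<close>.\<close>

lemma \<Gamma>_diff:
  assumes \<xi>: "\<xi> \<in> {a..b}" and \<eta>: "\<eta> \<in> {a..b}" and t: "t \<in> {a..b}"
  shows "\<Gamma> \<eta> t s - \<Gamma> \<xi> t s =
    integral {a..\<eta>} (\<lambda>u. \<Gamma> \<xi> t u \<bullet>\<^sub>k \<Gamma> \<eta> u s) - integral {a..\<xi>} (\<lambda>u. \<Gamma> \<xi> t u \<bullet>\<^sub>k \<Gamma> \<eta> u s)"
proof -
  define q where "q \<zeta> t = integral {a..\<zeta>} (\<lambda>u. \<Gamma> \<xi> t u \<bullet>\<^sub>k \<Gamma> \<eta> u s)" for \<zeta> t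
  have c\<Gamma>: "continuous_on X (\<lambda>u. \<Gamma> \<eta> u s)" for X using \<eta> by (intro continuous_intros)
  have cq: "continuous_on X (q \<zeta>)" if "\<zeta> \<in> {a..b}" for X \<zeta>
    unfolding q_def by (rule continuous_on_resolvent_integral[OF \<xi> that c\<Gamma>])
  have q: "q \<zeta> t - integral {a..\<xi>} (\<lambda>u. K t u \<bullet>\<^sub>k q \<zeta> u) = integral {a..\<zeta>} (\<lambda>u. K t u \<bullet>\<^sub>k \<Gamma> \<eta> u s)"
    if "\<zeta> \<in> {a..b}" for \<zeta> t
    unfolding q_def by (rule resolvent_integral_equation[OF \<xi> that c\<Gamma>])
  have "(\<Gamma> \<eta> t s - \<Gamma> \<xi> t s) - (q \<eta> t - q \<xi> t) = 0"
  proof (rule injective[OF \<xi> _ _ t, where h = "\<lambda>t. (\<Gamma> \<eta> t s - \<Gamma> \<xi> t s) - (q \<eta> t - q \<xi> t)"])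
    show "continuous_on {a..b} (\<lambda>t. (\<Gamma> \<eta> t s - \<Gamma> \<xi> t s) - (q \<eta> t - q \<xi> t))"
      using \<xi> \<eta> by (intro continuous_intros cq)
    fix t
    have "integral {a..\<xi>} (\<lambda>u. K t u \<bullet>\<^sub>k ((\<Gamma> \<eta> u s - \<Gamma> \<xi> u s) - (q \<eta> u - q \<xi> u))) =
        (integral {a..\<xi>} (\<lambda>u. K t u \<bullet>\<^sub>k \<Gamma> \<eta> u s) - integral {a..\<xi>} (\<lambda>u. K t u \<bullet>\<^sub>k \<Gamma> \<xi> u s)) -
        (integral {a..\<xi>} (\<lambda>u. K t u \<bullet>\<^sub>k q \<eta> u) - integral {a..\<xi>} (\<lambda>u. K t u \<bullet>\<^sub>k q \<xi> u))"
      using \<xi> \<eta> by (simp add: integral_K_diff cq c\<Gamma> continuous_on_diff continuous_on_\<Gamma>)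
    then show "(\<Gamma> \<eta> t s - \<Gamma> \<xi> t s) - (q \<eta> t - q \<xi> t) =
        integral {a..\<xi>} (\<lambda>u. K t u \<bullet>\<^sub>k ((\<Gamma> \<eta> u s - \<Gamma> \<xi> u s) - (q \<eta> u - q \<xi> u)))"
      using \<Gamma>_left[OF \<xi>, of t s] \<Gamma>_left[OF \<eta>, of t s] q[OF \<xi>, of t] q[OF \<eta>, of t] by (simp add: algebra_simps)
  qed
  then show ?thesis by (simp add: q_def)
qed

text \<open>By \<open>\<Gamma>_diff\<close> the increment is an integral over a shrinking interval
  with jointly continuous integrand, so its derivative is the value at
  \<open>u = \<eta> = \<xi>\<close>.\<close>

lemma \<Gamma>_has_vector_derivative:
  assumes \<xi>: "\<xi> \<in> {a..b}" and t: "t \<in> {a..b}"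
  shows "((\<lambda>\<eta>. \<Gamma> \<eta> t s) has_vector_derivative \<Gamma> \<xi> t \<xi> \<bullet>\<^sub>k \<Gamma> \<xi> \<xi> s) (at \<xi> within {a..b})"
proof -
  have "((\<lambda>\<eta>. \<Gamma> \<xi> t s + (integral {a..\<eta>} (\<lambda>u. \<Gamma> \<xi> t u \<bullet>\<^sub>k \<Gamma> \<eta> u s) -
      integral {a..\<xi>} (\<lambda>u. \<Gamma> \<xi> t u \<bullet>\<^sub>k \<Gamma> \<eta> u s))) has_vector_derivative \<Gamma> \<xi> t \<xi> \<bullet>\<^sub>k \<Gamma> \<xi> \<xi> s)
      (at \<xi> within {a..b})"
    by (rule has_vector_derivative_eq_rhs, rule has_vector_derivative_add[OF has_vector_derivative_const],
        rule has_vector_derivative_integral_increment)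
      (use \<xi> in \<open>auto simp: case_prod_unfold intro!: comp.continuous_on continuous_intros\<close>)
  then show ?thesis
    by (rule has_vector_derivative_transform[OF \<xi>, rotated]) (use \<Gamma>_diff[OF \<xi> _ t] in \<open>simp add: algebra_simps\<close>)
qed

end

section \<open>Derivatives with respect to the end point\<close>

locale kernel_system = kernel_family comp a b K + kernel_action comp act
  for comp :: "'k \<Rightarrow> 'k \<Rightarrow> 'k::euclidean_space" (infixl "\<bullet>\<^sub>k" 70) and a b K
    and act :: "'k \<Rightarrow> 'v \<Rightarrow> 'v::euclidean_space" (infixr "\<bullet>\<^sub>v" 70) +
  fixes one :: 'k
  assumes one_comp: "one \<bullet>\<^sub>k x = x" and one_act: "one \<bullet>\<^sub>v v = v"
begin

text \<open>The function \<open>\<phi>\<^sub>\<xi>\<close> of the overview. The formula also makes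
  sense for \<open>t\<close> beyond \<open>\<xi>\<close>, so that \<open>\<xi>\<close> can vary over
  all of \<open>[a,b]\<close> with \<open>t\<close> fixed.\<close>

definition sol :: "(real \<Rightarrow> 'v) \<Rightarrow> real \<Rightarrow> real \<Rightarrow> 'v" where
  "sol f \<xi> t = f t + integral {a..\<xi>} (\<lambda>s. \<Gamma> \<xi> t s \<bullet>\<^sub>v f s)"

text \<open>Here \<open>star \<xi> t\<close> is \<open>g\<^sup>*(t,\<xi>)\<close>: the constant row
  \<open>one\<close> multiplied from the right by \<open>1 + \<Gamma>\<close>.\<close>

definition star :: "real \<Rightarrow> real \<Rightarrow> 'k" where
  "star \<xi> t = one + integral {a..\<xi>} (\<lambda>s. \<Gamma> \<xi> s t)"

lemma continuous_on_sol:
  assumes f: "continuous_on {a..b} f" and x: "continuous_on X x" "\<And>p. p \<in> X \<Longrightarrow> x p \<in> {a..b}"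
    and t: "continuous_on X t" "\<And>p. p \<in> X \<Longrightarrow> t p \<in> {a..b}"
  shows "continuous_on X (\<lambda>p. sol f (x p) (t p))"
  unfolding sol_def
proof (intro continuous_on_add continuous_on_integral_variable_end[of X a b] x)
  show "continuous_on X (\<lambda>p. f (t p))" using t by (intro continuous_on_compose2[OF f]) auto
  show "continuous_on (X \<times> {a..b}) (\<lambda>(p, s). \<Gamma> (x p) (t p) s \<bullet>\<^sub>v f s)"
    unfolding case_prod_unfold
    using x(2) by (intro act.continuous_on continuous_on_\<Gamma> continuous_on_compose2[OF f] continuous_on_compose2[OF x(1)]
        continuous_on_compose2[OF t(1)] continuous_intros) auto
qed

text \<open>The left resolvent equation reads \<open>(1 - K)(1 + \<Gamma>) = 1\<close>. It is fed to
  \<open>quasi_inverse_solution\<close> with \<open>- K\<close> and \<open>- \<Gamma>\<close> as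
  \<open>A\<close> and \<open>B\<close>, so that \<open>f\<close> is recovered from
  \<open>sol f\<close>.\<close>

lemma sol_equation:
  assumes \<xi>: "\<xi> \<in> {a..b}" and f: "continuous_on {a..b} f" and t: "t \<in> {a..\<xi>}"
  shows "sol f \<xi> t - integral {a..\<xi>} (\<lambda>s. K t s \<bullet>\<^sub>v sol f \<xi> s) = f t"
proof -
  have f': "continuous_on {a..\<xi>} f" using f by (rule continuous_on_subset) (use \<xi> in auto)
  have "f t = sol f \<xi> t + integral {a..\<xi>} (\<lambda>s. (- K t s) \<bullet>\<^sub>v sol f \<xi> s)"
  proof (rule quasi_inverse_solution[where B = "\<lambda>t s. - \<Gamma> \<xi> t s", OF _ _ _ f' _ t])
    show "- K t s - integral {a..\<xi>} (\<lambda>u. (- K t u) \<bullet>\<^sub>k (- \<Gamma> \<xi> u s)) = - \<Gamma> \<xi> t s" for t s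
      using \<Gamma>_left[OF \<xi>, of t s] by (simp add: comp.minus_left comp.minus_right algebra_simps)
    show "f t - integral {a..\<xi>} (\<lambda>s. (- \<Gamma> \<xi> t s) \<bullet>\<^sub>v f s) = sol f \<xi> t" for t
      by (simp add: sol_def act.minus_left)
  qed (use \<xi> in \<open>auto simp: case_prod_unfold intro!: continuous_intros\<close>)
  then show ?thesis by (simp add: act.minus_left)
qed

text \<open>The right resolvent equation reads \<open>(1 + \<Gamma>)(1 - K) = 1\<close>, so any
  solution arises from \<open>f\<close> by \<open>1 + \<Gamma>\<close>.\<close>

lemma sol_unique:
  assumes \<xi>: "\<xi> \<in> {a..b}" and \<phi>: "continuous_on {a..\<xi>} \<phi>"
    and eq: "\<And>t. t \<in> {a..\<xi>} \<Longrightarrow> \<phi> t - integral {a..\<xi>} (\<lambda>s. K t s \<bullet>\<^sub>v \<phi> s) = f t"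
    and t: "t \<in> {a..\<xi>}"
  shows "\<phi> t = sol f \<xi> t"
  unfolding sol_def
proof (rule quasi_inverse_solution[where B = K, OF _ _ _ \<phi> eq t])
  show "\<Gamma> \<xi> t s - integral {a..\<xi>} (\<lambda>u. \<Gamma> \<xi> t u \<bullet>\<^sub>k K u s) = K t s" if "t \<in> {a..\<xi>}" for t s
    using that \<xi> by (intro \<Gamma>_right) auto
qed (use \<xi> in \<open>auto simp: case_prod_unfold intro!: continuous_intros\<close>)

text \<open>Both terms of the Leibniz rule have the left factor
  \<open>\<Gamma> \<xi> t \<xi>\<close>, thanks to the product form of the derivative of
  \<open>\<Gamma>\<close>; what remains is \<open>sol f \<xi> \<xi>\<close>.\<close>

lemma sol_has_vector_derivative:
  assumes \<xi>: "\<xi> \<in> {a..b}" and f: "continuous_on {a..b} f" and t: "t \<in> {a..b}"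
  shows "((\<lambda>\<eta>. sol f \<eta> t) has_vector_derivative \<Gamma> \<xi> t \<xi> \<bullet>\<^sub>v sol f \<xi> \<xi>) (at \<xi> within {a..b})"
proof -
  have "((\<lambda>\<eta>. f t + integral {a..\<eta>} (\<lambda>s. \<Gamma> \<eta> t s \<bullet>\<^sub>v f s)) has_vector_derivative
      0 + (\<Gamma> \<xi> t \<xi> \<bullet>\<^sub>v f \<xi> + integral {a..\<xi>} (\<lambda>s. (\<Gamma> \<xi> t \<xi> \<bullet>\<^sub>k \<Gamma> \<xi> \<xi> s) \<bullet>\<^sub>v f s))) (at \<xi> within {a..b})"
  proof (intro has_vector_derivative_add has_vector_derivative_const leibniz_rule_variable_end \<xi>)
    show "((\<lambda>\<eta>. \<Gamma> \<eta> t s \<bullet>\<^sub>v f s) has_vector_derivative (\<Gamma> \<eta> t \<eta> \<bullet>\<^sub>k \<Gamma> \<eta> \<eta> s) \<bullet>\<^sub>v f s) (at \<eta> within {a..b})"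
      if "\<eta> \<in> {a..b}" for \<eta> s
      by (intro bounded_linear.has_vector_derivative[OF act.bounded_linear_left] \<Gamma>_has_vector_derivative that t)
  qed (auto simp: case_prod_unfold intro!: continuous_intros act.continuous_on comp.continuous_on
      continuous_on_compose2[OF f])
  moreover have "integral {a..\<xi>} (\<lambda>s. (\<Gamma> \<xi> t \<xi> \<bullet>\<^sub>k \<Gamma> \<xi> \<xi> s) \<bullet>\<^sub>v f s) =
      \<Gamma> \<xi> t \<xi> \<bullet>\<^sub>v integral {a..\<xi>} (\<lambda>s. \<Gamma> \<xi> \<xi> s \<bullet>\<^sub>v f s)"
    unfolding act_assoc using \<xi>
    by (intro act.integral_prod_right[symmetric] integrable_continuous_interval act.continuous_on
        continuous_intros continuous_on_subset[OF f]) auto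
  ultimately show ?thesis by (simp add: sol_def act.add_right)
qed

lemma continuous_on_star:
  assumes x: "continuous_on X x" "\<And>p. p \<in> X \<Longrightarrow> x p \<in> {a..b}" and t: "continuous_on X t"
  shows "continuous_on X (\<lambda>p. star (x p) (t p))"
  unfolding star_def
proof (intro continuous_intros continuous_on_integral_variable_end[of X a b] x)
  show "continuous_on (X \<times> {a..b}) (\<lambda>(p, s). \<Gamma> (x p) s (t p))"
    unfolding case_prod_unfold
    using x(2) by (intro continuous_on_\<Gamma> continuous_on_compose2[OF x(1)]
        continuous_on_compose2[OF t(1)] continuous_intros) auto
qed

text \<open>Reversing the product turns an equation with the kernel on the right into one with the
  kernel on the left, so \<open>quasi_inverse_solution\<close> also covers the equation for
  \<open>star\<close>.\<close>

lemma opposite_action: "kernel_action (\<lambda>x y. y \<bullet>\<^sub>k x) (\<lambda>x y. y \<bullet>\<^sub>k x)"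
  by (intro kernel_action.intro kernel_algebra.intro kernel_action_axioms.intro
      bounded_bilinear.flip[OF bounded_bilinear_comp]) (simp_all add: comp_assoc)

text \<open>Reversal exchanges the roles of the two resolvent equations: existence now rests on
  \<open>\<Gamma>_right\<close>, and uniqueness in \<open>star_unique\<close> on
  \<open>\<Gamma>_left\<close>.\<close>

lemma star_equation:
  assumes \<xi>: "\<xi> \<in> {a..b}" and t: "t \<in> {a..\<xi>}"
  shows "star \<xi> t - integral {a..\<xi>} (\<lambda>s. star \<xi> s \<bullet>\<^sub>k K s t) = one"
proof -
  interpret opp: kernel_action "\<lambda>x y. y \<bullet>\<^sub>k x" "\<lambda>x y. y \<bullet>\<^sub>k x" by (rule opposite_action)
  have "one = star \<xi> t + integral {a..\<xi>} (\<lambda>s. star \<xi> s \<bullet>\<^sub>k (- K s t))"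
  \<comment> \<open>The constant \<open>one\<close> takes the place of the solution and
    \<open>star\<close> that of the right-hand side; the kernels enter with exchanged
    arguments.\<close>
  proof (rule opp.quasi_inverse_solution[where B = "\<lambda>t s. - \<Gamma> \<xi> s t" and A = "\<lambda>t s. - K s t" and \<phi> = "\<lambda>_. one",
        OF _ _ _ _ _ t])
    show "- K s t - integral {a..\<xi>} (\<lambda>u. (- \<Gamma> \<xi> s u) \<bullet>\<^sub>k (- K u t)) = - \<Gamma> \<xi> s t"
      if "s \<in> {a..\<xi>}" for t s
      using \<Gamma>_right[OF \<xi>, of s t] that \<xi> by (simp add: comp.minus_left comp.minus_right algebra_simps)
    show "one - integral {a..\<xi>} (\<lambda>s. one \<bullet>\<^sub>k (- \<Gamma> \<xi> s t)) = star \<xi> t" for t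
      by (simp add: star_def one_comp)
  qed (use \<xi> in \<open>auto simp: case_prod_unfold intro!: continuous_intros\<close>)
  then show ?thesis by (simp add: comp.minus_right)
qed

lemma star_unique:
  assumes \<xi>: "\<xi> \<in> {a..b}" and \<phi>: "continuous_on {a..\<xi>} \<phi>"
    and eq: "\<And>t. t \<in> {a..\<xi>} \<Longrightarrow> \<phi> t - integral {a..\<xi>} (\<lambda>s. \<phi> s \<bullet>\<^sub>k K s t) = one"
    and t: "t \<in> {a..\<xi>}"
  shows "\<phi> t = star \<xi> t"
proof -
  interpret opp: kernel_action "\<lambda>x y. y \<bullet>\<^sub>k x" "\<lambda>x y. y \<bullet>\<^sub>k x" by (rule opposite_action)
  have "\<phi> t = one + integral {a..\<xi>} (\<lambda>s. one \<bullet>\<^sub>k \<Gamma> \<xi> s t)"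
  proof (rule opp.quasi_inverse_solution[where B = "\<lambda>t s. K s t" and A = "\<lambda>t s. \<Gamma> \<xi> s t" and f = "\<lambda>_. one",
        OF _ _ _ \<phi> eq t])
    show "\<Gamma> \<xi> s t - integral {a..\<xi>} (\<lambda>u. K s u \<bullet>\<^sub>k \<Gamma> \<xi> u t) = K s t" for t s
      by (rule \<Gamma>_left[OF \<xi>])
  qed (use \<xi> in \<open>auto simp: case_prod_unfold intro!: continuous_intros\<close>)
  then show ?thesis by (simp add: star_def one_comp)
qed

text \<open>The right factor \<open>\<Gamma> \<xi> \<xi> t\<close> is common to the boundary term,
  where it is multiplied by \<open>one\<close>, and to the integral.\<close>

lemma star_has_vector_derivative:
  assumes \<xi>: "\<xi> \<in> {a..b}"
  shows "((\<lambda>\<eta>. star \<eta> t) has_vector_derivative star \<xi> \<xi> \<bullet>\<^sub>k \<Gamma> \<xi> \<xi> t) (at \<xi> within {a..b})"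
proof -
  have "((\<lambda>\<eta>. one + integral {a..\<eta>} (\<lambda>s. \<Gamma> \<eta> s t)) has_vector_derivative
      0 + (\<Gamma> \<xi> \<xi> t + integral {a..\<xi>} (\<lambda>s. \<Gamma> \<xi> s \<xi> \<bullet>\<^sub>k \<Gamma> \<xi> \<xi> t))) (at \<xi> within {a..b})"
    by (intro has_vector_derivative_add has_vector_derivative_const leibniz_rule_variable_end \<xi>
        \<Gamma>_has_vector_derivative)
      (auto simp: case_prod_unfold intro!: continuous_intros comp.continuous_on)
  moreover have "integral {a..\<xi>} (\<lambda>s. \<Gamma> \<xi> s \<xi> \<bullet>\<^sub>k \<Gamma> \<xi> \<xi> t) =
      integral {a..\<xi>} (\<lambda>s. \<Gamma> \<xi> s \<xi>) \<bullet>\<^sub>k \<Gamma> \<xi> \<xi> t"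
    using \<xi> by (intro comp.integral_prod_left[symmetric] integrable_continuous_interval continuous_intros) auto
  ultimately show ?thesis by (simp add: star_def comp.add_left one_comp)
qed

text \<open>The factor \<open>star \<xi> \<xi>\<close> comes out of both Leibniz terms and leaves
  \<open>sol f \<xi> \<xi>\<close>. For matrices acting on themselves and \<open>f\<close>
  constantly \<open>mat 1\<close> this also differentiates \<open>M\<close>.\<close>

lemma moment_has_vector_derivative:
  assumes \<xi>: "\<xi> \<in> {a..b}" and f: "continuous_on {a..b} f"
  shows "((\<lambda>\<eta>. integral {a..\<eta>} (\<lambda>s. star \<eta> s \<bullet>\<^sub>v f s)) has_vector_derivative star \<xi> \<xi> \<bullet>\<^sub>v sol f \<xi> \<xi>)
    (at \<xi> within {a..b})"
proof -
  have "((\<lambda>\<eta>. integral {a..\<eta>} (\<lambda>s. star \<eta> s \<bullet>\<^sub>v f s)) has_vector_derivative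
      star \<xi> \<xi> \<bullet>\<^sub>v f \<xi> + integral {a..\<xi>} (\<lambda>s. (star \<xi> \<xi> \<bullet>\<^sub>k \<Gamma> \<xi> \<xi> s) \<bullet>\<^sub>v f s)) (at \<xi> within {a..b})"
  proof (intro leibniz_rule_variable_end \<xi>)
    show "((\<lambda>\<eta>. star \<eta> s \<bullet>\<^sub>v f s) has_vector_derivative (star \<eta> \<eta> \<bullet>\<^sub>k \<Gamma> \<eta> \<eta> s) \<bullet>\<^sub>v f s) (at \<eta> within {a..b})"
      if "\<eta> \<in> {a..b}" for \<eta> s
      by (intro bounded_linear.has_vector_derivative[OF act.bounded_linear_left] star_has_vector_derivative that)
  qed (auto simp: case_prod_unfold intro!: continuous_intros act.continuous_on comp.continuous_on
      continuous_on_compose2[OF f] continuous_on_star)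
  moreover have "integral {a..\<xi>} (\<lambda>s. (star \<xi> \<xi> \<bullet>\<^sub>k \<Gamma> \<xi> \<xi> s) \<bullet>\<^sub>v f s) =
      star \<xi> \<xi> \<bullet>\<^sub>v integral {a..\<xi>} (\<lambda>s. \<Gamma> \<xi> \<xi> s \<bullet>\<^sub>v f s)"
    unfolding act_assoc using \<xi>
    by (intro act.integral_prod_right[symmetric] integrable_continuous_interval act.continuous_on
        continuous_intros continuous_on_subset[OF f]) auto
  ultimately show ?thesis by (simp add: sol_def act.add_right)
qed

end

section \<open>Matrices\<close>

lemma bounded_bilinear_matrix_mult: "bounded_bilinear ((**) :: complex^'n^'n \<Rightarrow> complex^'n^'n \<Rightarrow> complex^'n^'n)"
  unfolding bilinear_conv_bounded_bilinear[symmetric] bilinear_def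
  by (auto intro!: linearI simp: vec_eq_iff matrix_matrix_mult_def sum.distrib algebra_simps scaleR_sum_right)

lemma bounded_bilinear_matrix_vector_mult: "bounded_bilinear ((*v) :: complex^'n^'n \<Rightarrow> complex^'n \<Rightarrow> complex^'n)"
  unfolding bilinear_conv_bounded_bilinear[symmetric] bilinear_def
  by (auto intro!: linearI simp: vec_eq_iff matrix_vector_mult_def sum.distrib algebra_simps scaleR_sum_right)

lemma continuous_on_det:
  fixes A :: "'x::topological_space \<Rightarrow> complex^'n^'n"
  assumes "continuous_on S A"
  shows "continuous_on S (\<lambda>x. det (A x))"
  unfolding det_def by (intro continuous_intros assms)

text \<open>Multiplying the left side by \<open>A\<close> cancels the inverse, and \<open>A\<close>
  is itself invertible. With \<open>star\<close> as \<open>A\<close> and \<open>g\<close> as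
  \<open>B\<close> it turns \<open>V_fun\<close> into the inverse of \<open>g\<close> applied to
  \<open>\<phi>\<close>.\<close>

lemma matrix_inv_mult_left:
  fixes A B :: "complex^'n^'n"
  assumes "det (A ** B) \<noteq> 0"
  shows "B *v (matrix_inv (A ** B) *v (A *v x)) = x"
proof -
  have "det A \<noteq> 0" using assms by (simp add: det_mul)
  have "invertible (A ** B)" using assms by (simp add: invertible_det_nz)
  then have "(A ** B) ** matrix_inv (A ** B) = mat 1"
    unfolding matrix_inv_def invertible_def by (rule someI2_ex) auto
  then have "A *v (B *v (matrix_inv (A ** B) *v (A *v x))) = A *v x"
    by (simp add: matrix_vector_mul_assoc matrix_mul_assoc)
  moreover obtain A' where "A' ** A = mat 1"
    using \<open>det A \<noteq> 0\<close> by (metis invertible_det_nz invertible_def)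
  ultimately show ?thesis
    by (metis matrix_vector_mul_assoc matrix_vector_mul_lid)
qed

text \<open>Cramer's rule exhibits the solution of a linear system as a continuous function of the data.\<close>

lemma continuous_on_linear_system:
  fixes A :: "'x::topological_space \<Rightarrow> complex^'n^'n"
  assumes A: "continuous_on S A" "\<And>x. x \<in> S \<Longrightarrow> det (A x) \<noteq> 0" and c: "continuous_on S (\<lambda>x. A x *v v x)"
  shows "continuous_on S v"
proof -
  have "v x = (\<chi> k. det (\<chi> i j. if j = k then (A x *v v x) $ i else A x $ i $ j) / det (A x))" if "x \<in> S" for x
    using cramer[OF A(2)[OF that], of "v x" "A x *v v x"] by simp
  moreover have "continuous_on S (\<lambda>x. \<chi> k. det (\<chi> i j. if j = k then (A x *v v x) $ i else A x $ i $ j) / det (A x))"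
  proof (intro continuous_intros continuous_on_det A(1))
    show "\<forall>x\<in>S. det (A x) \<noteq> 0" using A(2) by blast
    show "continuous_on S (\<lambda>x. if j = k then (A x *v v x) $ i else A x $ i $ j)" for i j k :: 'n
      by (cases "j = k") (auto intro!: continuous_intros c A(1))
  qed
  ultimately show ?thesis by (simp cong: continuous_on_cong)
qed

section \<open>Integration by parts for Riemann--Stieltjes integrals\<close>

lemma vector_derivative_increment_le:
  fixes f :: "real \<Rightarrow> 'v::real_normed_vector"
  assumes "\<And>s. s \<in> {u..v} \<Longrightarrow> (f has_vector_derivative f' s) (at s within {u..v})"
    and "\<And>s. s \<in> {u..v} \<Longrightarrow> norm (f' s) \<le> B" and x: "x \<in> {u..v}" and y: "y \<in> {u..v}"
  shows "norm (f y - f x) \<le> B * \<bar>y - x\<bar>"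
proof -
  have "B \<ge> 0" using assms(2)[OF x] norm_ge_zero order_trans by blast
  have "onorm (\<lambda>h. h *\<^sub>R f' s) \<le> B" if "s \<in> {u..v}" for s
    using assms(2)[OF that] \<open>B \<ge> 0\<close> by (intro onorm_bound) (auto simp: mult.commute[of B] intro: mult_left_mono)
  then have "norm (f y - f x) \<le> B * norm (y - x)"
    using assms(1) unfolding has_vector_derivative_def
    by (intro differentiable_bound[OF convex_real_interval(5)]) (use x y in auto)
  then show ?thesis by simp
qed

text \<open>The Stieltjes sum is compared with the telescoping sum of the increments of
  \<open>P = G V - W\<close>, where \<open>W\<close> stands for a primitive of \<open>G' V\<close>.
  The function \<open>V\<close> itself is never differentiated.\<close>

lemma has_stieltjes_integral_by_parts:
  fixes G G' :: "real \<Rightarrow> complex^'n^'n" and V W :: "real \<Rightarrow> complex^'n"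
  assumes "c \<le> d"
    and G: "\<And>s. s \<in> {c..d} \<Longrightarrow> (G has_vector_derivative G' s) (at s within {c..d})"
    and G': "continuous_on {c..d} G'" and V: "continuous_on {c..d} V"
    and W: "\<And>s. s \<in> {c..d} \<Longrightarrow> (W has_vector_derivative G' s *v V s) (at s within {c..d})"
  shows "has_stieltjes_integral G V (G d *v V d - G c *v V c - (W d - W c)) c d"
  unfolding has_stieltjes_integral_def
proof (intro allI impI)
  fix e :: real assume "e > 0"
  interpret mv: bounded_bilinear "(*v) :: complex^'n^'n \<Rightarrow> complex^'n \<Rightarrow> complex^'n"
    by (rule bounded_bilinear_matrix_vector_mult)
  obtain C where C: "C > 0" "\<And>(A :: complex^'n^'n) (v :: complex^'n). norm (A *v v) \<le> norm A * norm v * C"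
    using mv.pos_bounded by blast
  have "bounded (G' ` {c..d})" by (intro compact_imp_bounded compact_continuous_image G') simp
  then obtain N where N: "N > 0" "\<And>s. s \<in> {c..d} \<Longrightarrow> norm (G' s) \<le> N" by (auto simp: bounded_pos)
  define B where "B = N * C"
  have B: "B > 0" using N C by (simp add: B_def)
  have G'_le: "norm (G' s *v w) \<le> B * norm w" if "s \<in> {c..d}" for s w
  proof -
    have "norm (G' s *v w) \<le> norm (G' s) * norm w * C" by (rule C)
    also have "\<dots> \<le> N * norm w * C" using N(2)[OF that] C by (intro mult_right_mono) auto
    finally show ?thesis by (simp add: B_def mult_ac)
  qed
  \<comment> \<open>The local errors will add up to \<open>B * \<epsilon> * (d - c)\<close>, which
    is below \<open>e\<close>; the \<open>+ 1\<close> keeps the denominator positive when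
    \<open>c = d\<close>.\<close>
  define \<epsilon> where "\<epsilon> = e / (B * (d - c) + 1)"
  have pos: "B * (d - c) + 1 > 0" using B \<open>c \<le> d\<close> by (simp add: add_nonneg_pos)
  have \<epsilon>: "\<epsilon> > 0" using \<open>e > 0\<close> pos by (simp add: \<epsilon>_def)
  have "uniformly_continuous_on {c..d} V" using V by (intro compact_uniformly_continuous) auto
  then obtain \<delta> where \<delta>: "\<delta> > 0" "\<And>s s'. s \<in> {c..d} \<Longrightarrow> s' \<in> {c..d} \<Longrightarrow> \<bar>s - s'\<bar> < \<delta> \<Longrightarrow> norm (V s - V s') < \<epsilon>"
    using \<epsilon> unfolding uniformly_continuous_on_def dist_norm by (metis real_norm_def)
  define P where "P s = G s *v V s - W s" for s
  have local: "norm (G x *v (V v - V u) - (P v - P u)) \<le> B * \<epsilon> * (v - u)"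
    if uv: "{u..v} \<subseteq> {c..d}" "x \<in> {u..v}" and fine: "{u..v} \<subseteq> ball x (\<delta> / 2)" for x u v
  proof -
    \<comment> \<open>Freezing the value \<open>V y\<close> leaves a function of \<open>s\<close>
      with derivative \<open>G' s *v (V y - V s)\<close>, small on a short piece by uniform
      continuity of \<open>V\<close>.\<close>
    have le: "norm ((G y *v V y - W y) - (G x *v V y - W x)) \<le> B * \<epsilon> * \<bar>y - x\<bar>" if y: "y \<in> {u..v}" for y
    proof (rule vector_derivative_increment_le[of u v "\<lambda>s. G s *v V y - W s" "\<lambda>s. G' s *v V y - G' s *v V s", OF _ _ uv(2) y])
      fix s assume s: "s \<in> {u..v}"
      show "((\<lambda>s. G s *v V y - W s) has_vector_derivative G' s *v V y - G' s *v V s) (at s within {u..v})"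
        using s uv(1)
        by (intro has_vector_derivative_diff bounded_linear.has_vector_derivative[OF mv.bounded_linear_left]
            has_vector_derivative_within_subset[OF G] has_vector_derivative_within_subset[OF W]) auto
      have "y \<in> ball x (\<delta> / 2)" "s \<in> ball x (\<delta> / 2)" using fine y s by blast+
      then have "\<bar>y - s\<bar> < \<delta>" unfolding mem_ball dist_real_def by linarith
      then have "norm (V y - V s) \<le> \<epsilon>" using \<delta>(2)[of y s] uv(1) y s by (auto intro: less_imp_le)
      then have "B * norm (V y - V s) \<le> B * \<epsilon>" using B by simp
      then show "norm (G' s *v V y - G' s *v V s) \<le> B * \<epsilon>"
        using G'_le[of s "V y - V s"] uv(1) s by (auto simp: mv.diff_right)
    qed
    \<comment> \<open>The increment of \<open>P\<close> is split at the tag \<open>x\<close>, with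
      \<open>V\<close> frozen at \<open>u\<close> on one side and at \<open>v\<close> on the
      other.\<close>
    have "G x *v (V v - V u) - (P v - P u) =
        ((G u *v V u - W u) - (G x *v V u - W x)) - ((G v *v V v - W v) - (G x *v V v - W x))"
      by (simp add: P_def mv.diff_right)
    then have "norm (G x *v (V v - V u) - (P v - P u)) \<le> norm ((G u *v V u - W u) - (G x *v V u - W x)) + norm ((G v *v V v - W v) - (G x *v V v - W x))"
      by (simp only: norm_triangle_ineq4)
    also have "\<dots> \<le> B * \<epsilon> * \<bar>u - x\<bar> + B * \<epsilon> * \<bar>v - x\<bar>"
      using uv(2) by (intro add_mono le) auto
    also have "\<dots> = B * \<epsilon> * (v - u)" using uv(2) by (simp add: algebra_simps)
    finally show ?thesis .
  qed
  show "\<exists>\<delta>>0. \<forall>p. p tagged_division_of {c..d} \<and> (\<lambda>x. ball x \<delta>) fine p \<longrightarrow>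
      norm ((\<Sum>(x, k)\<in>p. G x *v (V (Sup k) - V (Inf k))) - (G d *v V d - G c *v V c - (W d - W c))) < e"
  \<comment> \<open>Two points of a piece lie within \<open>\<delta> / 2\<close> of its tag, hence
    within \<open>\<delta>\<close> of each other.\<close>
  proof (intro exI[of _ "\<delta> / 2"] conjI allI impI)
    show "\<delta> / 2 > 0" using \<delta> by simp
    fix p assume "p tagged_division_of {c..d} \<and> (\<lambda>x. ball x (\<delta> / 2)) fine p"
    then have p: "p tagged_division_of {c..d}" and fine: "(\<lambda>x. ball x (\<delta> / 2)) fine p" by auto
    have "G d *v V d - G c *v V c - (W d - W c) = (\<Sum>(x, k)\<in>p. P (Sup k) - P (Inf k))"
      using additive_tagged_division_1[OF \<open>c \<le> d\<close> p, of P] by (simp add: P_def)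
    then have "(\<Sum>(x, k)\<in>p. G x *v (V (Sup k) - V (Inf k))) - (G d *v V d - G c *v V c - (W d - W c)) =
        (\<Sum>(x, k)\<in>p. G x *v (V (Sup k) - V (Inf k)) - (P (Sup k) - P (Inf k)))"
      by (simp add: case_prod_unfold flip: sum_subtractf)
    moreover have "norm (\<Sum>(x, k)\<in>p. G x *v (V (Sup k) - V (Inf k)) - (P (Sup k) - P (Inf k))) \<le>
        (\<Sum>(x, k)\<in>p. B * \<epsilon> * (Sup k - Inf k))"
      unfolding case_prod_unfold
    proof (rule sum_norm_le)
      fix q assume "q \<in> p"
      then obtain x k where q: "q = (x, k)" "(x, k) \<in> p" by (cases q) auto
      obtain u v where k: "k = {u..v}" using tagged_division_ofD(4)[OF p q(2)] by auto
      have xk: "x \<in> k" "k \<subseteq> {c..d}" using tagged_division_ofD(2,3)[OF p q(2)] by auto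
      then have "Sup k = v" "Inf k = u" using k by auto
      then show "norm (G (fst q) *v (V (Sup (snd q)) - V (Inf (snd q))) - (P (Sup (snd q)) - P (Inf (snd q)))) \<le>
          B * \<epsilon> * (Sup (snd q) - Inf (snd q))"
        using local[of u v x] xk k q(1) fineD[OF fine q(2)] by simp
    qed
    moreover have "(\<Sum>(x, k)\<in>p. B * \<epsilon> * (Sup k - Inf k)) = B * \<epsilon> * (d - c)"
      using additive_tagged_division_1[OF \<open>c \<le> d\<close> p, of "\<lambda>x. x"]
      by (simp add: case_prod_unfold flip: sum_distrib_left)
    moreover have "B * \<epsilon> * (d - c) < e"
    proof -
      have "\<epsilon> * (B * (d - c) + 1) = e" using pos by (simp add: \<epsilon>_def)
      then show ?thesis using \<epsilon> by (simp add: algebra_simps)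
    qed
    ultimately show "norm ((\<Sum>(x, k)\<in>p. G x *v (V (Sup k) - V (Inf k))) - (G d *v V d - G c *v V c - (W d - W c))) < e"
      by simp
  qed
qed

section \<open>The system of integral equations\<close>

definition clamp_kernel :: "real \<Rightarrow> real \<Rightarrow> (real \<Rightarrow> real \<Rightarrow> 'k) \<Rightarrow> real \<Rightarrow> real \<Rightarrow> 'k" where
  "clamp_kernel a b K t s = K (max a (min b t)) (max a (min b s))"

lemma clamp_kernel_eq [simp]:
  "t \<in> {a..b} \<Longrightarrow> s \<in> {a..b} \<Longrightarrow> clamp_kernel a b K t s = K t s"
  by (simp add: clamp_kernel_def)

lemma unique_solution_onD: "unique_solution_on S E h \<Longrightarrow> E h' \<Longrightarrow> t \<in> S \<Longrightarrow> h' t = h t"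
  by (auto simp: unique_solution_on_def)

text \<open>The point is injectivity: adding a homogeneous solution \<open>h\<close> to the solution
  of the equation for \<open>g\<close> gives another solution, so uniqueness makes \<open>h\<close>
  vanish on \<open>[a,\<xi>]\<close>, and then the homogeneous equation makes it vanish on
  \<open>[a,b]\<close>.\<close>

lemma kernel_family_clamp_kernel:
  fixes K :: "real \<Rightarrow> real \<Rightarrow> complex^'n^'n"
  assumes ab: "a < b" and K: "continuous_on ({a..b} \<times> {a..b}) (\<lambda>(t, s). K t s)"
    and uniq: "\<forall>\<xi>\<in>{a<..b}. \<exists>h. unique_solution_on {a..\<xi>} (g_equation K a \<xi>) h"
  shows "kernel_family (**) a b (clamp_kernel a b K)"
proof (intro kernel_family.intro kernel_algebra.intro kernel_family_axioms.intro)
  show "bounded_bilinear ((**) :: complex^'n^'n \<Rightarrow> complex^'n^'n \<Rightarrow> complex^'n^'n)" by (rule bounded_bilinear_matrix_mult)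
  show "x ** y ** z = x ** (y ** z)" for x y z :: "complex^'n^'n" by (simp add: matrix_mul_assoc)
  show "a < b" by fact
  show "continuous_on UNIV (\<lambda>(t, s). clamp_kernel a b K t s)"
    unfolding clamp_kernel_def case_prod_unfold using ab
    by (intro continuous_on_compose2[OF K, of _ "\<lambda>p. (max a (min b (fst p)), max a (min b (snd p)))", simplified]
        continuous_intros) auto
  show "clamp_kernel a b K t s = clamp_kernel a b K (max a (min b t)) (max a (min b s))" for t s
    using ab by (simp add: clamp_kernel_def)
  show "h t = 0" if \<xi>: "\<xi> \<in> {a..b}" and h: "continuous_on {a..b} h"
    and eq: "\<And>t. t \<in> {a..b} \<Longrightarrow> h t = integral {a..\<xi>} (\<lambda>s. clamp_kernel a b K t s ** h s)"
    and t: "t \<in> {a..b}" for \<xi> t and h :: "real \<Rightarrow> complex^'n^'n"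
  proof -
    have zero: "h s = 0" if s: "s \<in> {a..\<xi>}" "a < \<xi>" for s
    proof -
      obtain g where g: "unique_solution_on {a..\<xi>} (g_equation K a \<xi>) g"
        using uniq \<xi> s by fastforce
      then have g_eq: "g_equation K a \<xi> g" by (simp add: unique_solution_on_def)
      have h': "continuous_on {a..\<xi>} h" using h by (rule continuous_on_subset) (use \<xi> in auto)
      have g_h: "g_equation K a \<xi> (\<lambda>s. g s + h s)"
        unfolding g_equation_def
      proof (intro conjI ballI)
        show "continuous_on {a..\<xi>} (\<lambda>s. g s + h s)"
          using g_eq h' by (intro continuous_on_add) (simp_all add: g_equation_def)
        fix t assume t: "t \<in> {a..\<xi>}"
        have Kt: "continuous_on {a..\<xi>} (K t)"
          using t \<xi> by (intro continuous_on_compose2[OF K, of _ "\<lambda>s. (t, s)", simplified] continuous_intros) auto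
        have "integral {a..\<xi>} (\<lambda>s. K t s ** (g s + h s)) =
            integral {a..\<xi>} (\<lambda>s. K t s ** g s) + integral {a..\<xi>} (\<lambda>s. K t s ** h s)"
          using g_eq unfolding matrix_add_ldistrib
          by (intro integral_add integrable_continuous_interval
              bounded_bilinear.continuous_on[OF bounded_bilinear_matrix_mult] Kt h') (simp add: g_equation_def)
        moreover have "integral {a..\<xi>} (\<lambda>s. K t s ** h s) = h t"
          using t \<xi> by (subst eq) (auto intro!: integral_cong)
        moreover have "g t - integral {a..\<xi>} (\<lambda>s. K t s ** g s) = mat 1"
          using g_eq t by (simp add: g_equation_def)
        ultimately show "g t + h t - integral {a..\<xi>} (\<lambda>s. K t s ** (g s + h s)) = mat 1"
          by (simp add: algebra_simps)
      qed
      have "g s + h s = g s + 0"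
        unfolding add_0_right by (rule unique_solution_onD[OF g, OF g_h s(1)])
      then show ?thesis by (rule add_left_imp_eq)
    qed
    \<comment> \<open>This also settles arguments \<open>t\<close> beyond \<open>\<xi>\<close>. For
      \<open>\<xi> = a\<close> the interval is a point and uniqueness is not called upon.\<close>
    have "integral {a..\<xi>} (\<lambda>s. clamp_kernel a b K t s ** h s) = integral {a..\<xi>} (\<lambda>s. 0)"
    proof (cases "a < \<xi>")
      case True
      with zero show ?thesis
        by (intro integral_cong) (simp add: bounded_bilinear.zero_right[OF bounded_bilinear_matrix_mult])
    qed (use \<xi> in auto)
    then show ?thesis using eq[OF t] by simp
  qed
qed

section \<open>Matrix kernels: \<open>g\<close>, \<open>g\<^sup>*\<close>, the resolvent kernel and
  \<open>M\<close>\<close>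

locale matrix_fredholm =
  fixes a b :: real and K :: "real \<Rightarrow> real \<Rightarrow> complex^'n^'n"
  assumes ab: "a < b"
    and K_cont: "continuous_on ({a..b} \<times> {a..b}) (\<lambda>(t, s). K t s)"
    and unique: "\<forall>\<xi>\<in>{a<..b}. \<exists>h. unique_solution_on {a..\<xi>} (g_equation K a \<xi>) h"
begin

text \<open>Matrices acting on themselves, for the equations of \<open>g\<close> and
  \<open>star\<close>.\<close>

sublocale M: kernel_system "(**)" a b "clamp_kernel a b K"
    "(**) :: complex^'n^'n \<Rightarrow> complex^'n^'n \<Rightarrow> complex^'n^'n" "mat 1"
  by (intro kernel_system.intro kernel_family_clamp_kernel ab K_cont unique kernel_action.intro
      kernel_action_axioms.intro kernel_algebra.intro kernel_system_axioms.intro bounded_bilinear_matrix_mult)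
    (simp_all add: matrix_mul_assoc)

text \<open>Matrices acting on vectors, for the equation of \<open>\<phi>\<close>. The kernel family
  is the same, and so is its resolvent kernel \<open>\<Gamma>\<close>.\<close>

sublocale V: kernel_system "(**)" a b "clamp_kernel a b K" "(*v)" "mat 1"
  by (intro kernel_system.intro M.kernel_family_axioms kernel_action.intro M.kernel_algebra_axioms
      kernel_action_axioms.intro kernel_system_axioms.intro bounded_bilinear_matrix_vector_mult)
    (simp_all add: matrix_vector_mul_assoc)

text \<open>The argument order is opposite to that of \<open>g_sol\<close>: \<open>g \<xi> t\<close>
  is \<open>g(t,\<xi>)\<close>.\<close>

abbreviation "g \<equiv> M.sol (\<lambda>_. mat 1)"

lemma g_equation_clamp:
  assumes "\<xi> \<in> {a..b}"
  shows "g_equation K a \<xi> h \<longleftrightarrow> continuous_on {a..\<xi>} h \<and>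
    (\<forall>t\<in>{a..\<xi>}. h t - integral {a..\<xi>} (\<lambda>s. clamp_kernel a b K t s ** h s) = mat 1)"
proof -
  have "integral {a..\<xi>} (\<lambda>s. K t s ** h s) = integral {a..\<xi>} (\<lambda>s. clamp_kernel a b K t s ** h s)"
    if "t \<in> {a..\<xi>}" for t using that assms by (intro integral_cong) simp
  then show ?thesis by (simp add: g_equation_def)
qed

lemma g_star_equation_clamp:
  assumes "\<xi> \<in> {a..b}"
  shows "g_star_equation K a \<xi> h \<longleftrightarrow> continuous_on {a..\<xi>} h \<and>
    (\<forall>t\<in>{a..\<xi>}. h t - integral {a..\<xi>} (\<lambda>s. h s ** clamp_kernel a b K s t) = mat 1)"
proof -
  have "integral {a..\<xi>} (\<lambda>s. h s ** K s t) = integral {a..\<xi>} (\<lambda>s. h s ** clamp_kernel a b K s t)"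
    if "t \<in> {a..\<xi>}" for t using that assms by (intro integral_cong) simp
  then show ?thesis by (simp add: g_star_equation_def)
qed

lemma g_equation_g: "\<xi> \<in> {a..b} \<Longrightarrow> g_equation K a \<xi> (g \<xi>)"
  by (auto simp: g_equation_clamp M.sol_equation intro!: M.continuous_on_sol continuous_intros)

lemma g_star_equation_star: "\<xi> \<in> {a..b} \<Longrightarrow> g_star_equation K a \<xi> (M.star \<xi>)"
  by (auto simp: g_star_equation_clamp M.star_equation intro!: M.continuous_on_star continuous_intros)

lemma g_equation_imp_eq: "\<xi> \<in> {a..b} \<Longrightarrow> g_equation K a \<xi> h \<Longrightarrow> t \<in> {a..\<xi>} \<Longrightarrow> h t = g \<xi> t"
  unfolding g_equation_clamp by (rule M.sol_unique) auto

lemma g_star_equation_imp_eq: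
  "\<xi> \<in> {a..b} \<Longrightarrow> g_star_equation K a \<xi> h \<Longrightarrow> t \<in> {a..\<xi>} \<Longrightarrow> h t = M.star \<xi> t"
  unfolding g_star_equation_clamp by (rule M.star_unique) auto

lemma g_sol_solves: "\<xi> \<in> {a..b} \<Longrightarrow> g_equation K a \<xi> (\<lambda>t. g_sol K a t \<xi>)"
  unfolding g_sol_def by (rule someI[of "g_equation K a \<xi>", OF g_equation_g])

lemma g_star_sol_solves: "\<xi> \<in> {a..b} \<Longrightarrow> g_star_equation K a \<xi> (\<lambda>t. g_star_sol K a t \<xi>)"
  unfolding g_star_sol_def by (rule someI[of "g_star_equation K a \<xi>", OF g_star_equation_star])

lemma g_sol_eq: "\<xi> \<in> {a..b} \<Longrightarrow> t \<in> {a..\<xi>} \<Longrightarrow> g_sol K a t \<xi> = g \<xi> t"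
  by (rule g_equation_imp_eq[OF _ g_sol_solves])

lemma g_star_sol_eq: "\<xi> \<in> {a..b} \<Longrightarrow> t \<in> {a..\<xi>} \<Longrightarrow> g_star_sol K a t \<xi> = M.star \<xi> t"
  by (rule g_star_equation_imp_eq[OF _ g_star_sol_solves])

lemma unique_g: "\<xi> \<in> {a..b} \<Longrightarrow> unique_solution_on {a..\<xi>} (g_equation K a \<xi>) (\<lambda>t. g_sol K a t \<xi>)"
  unfolding unique_solution_on_def by (simp add: g_sol_solves g_sol_eq g_equation_imp_eq)

lemma unique_g_star:
  "\<xi> \<in> {a..b} \<Longrightarrow> unique_solution_on {a..\<xi>} (g_star_equation K a \<xi>) (\<lambda>t. g_star_sol K a t \<xi>)"
  unfolding unique_solution_on_def by (simp add: g_star_sol_solves g_star_sol_eq g_star_equation_imp_eq)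

lemma is_resolvent_kernel_\<Gamma>:
  assumes \<xi>: "\<xi> \<in> {a..b}"
  shows "is_resolvent_kernel K a \<xi> (M.\<Gamma> \<xi>)"
  unfolding is_resolvent_kernel_def
proof (intro conjI ballI)
  show "continuous_on ({a..\<xi>} \<times> {a..\<xi>}) (\<lambda>(t, s). M.\<Gamma> \<xi> t s)"
    unfolding case_prod_unfold using \<xi> by (intro M.continuous_on_\<Gamma> continuous_intros)
  fix t s assume ts: "t \<in> {a..\<xi>}" "s \<in> {a..\<xi>}"
  have "integral {a..\<xi>} (\<lambda>u. K t u ** M.\<Gamma> \<xi> u s) = integral {a..\<xi>} (\<lambda>u. clamp_kernel a b K t u ** M.\<Gamma> \<xi> u s)"
    using ts \<xi> by (intro integral_cong) simp
  then show "M.\<Gamma> \<xi> t s - integral {a..\<xi>} (\<lambda>u. K t u ** M.\<Gamma> \<xi> u s) = K t s"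
    using M.\<Gamma>_left[OF \<xi>, of t s] ts \<xi> by simp
  have "integral {a..\<xi>} (\<lambda>u. M.\<Gamma> \<xi> t u ** K u s) = integral {a..\<xi>} (\<lambda>u. M.\<Gamma> \<xi> t u ** clamp_kernel a b K u s)"
    using ts \<xi> by (intro integral_cong) simp
  then show "M.\<Gamma> \<xi> t s - integral {a..\<xi>} (\<lambda>u. M.\<Gamma> \<xi> t u ** K u s) = K t s"
    using M.\<Gamma>_right[OF \<xi>, of t s] ts \<xi> by simp
qed

lemma resolvent_kernel_solves: "\<xi> \<in> {a..b} \<Longrightarrow> is_resolvent_kernel K a \<xi> (resolvent_kernel K a \<xi>)"
  unfolding resolvent_kernel_def by (rule someI[of "is_resolvent_kernel K a \<xi>", OF is_resolvent_kernel_\<Gamma>])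

text \<open>For fixed \<open>s\<close> the left resolvent equation determines the column by
  \<open>M.sol_unique\<close>, and \<open>M.\<Gamma>_right\<close> says that the column of
  \<open>\<Gamma>\<close> is that same solution.\<close>

lemma resolvent_kernel_eq:
  assumes \<xi>: "\<xi> \<in> {a..b}" and t: "t \<in> {a..\<xi>}" and s: "s \<in> {a..\<xi>}"
  shows "resolvent_kernel K a \<xi> t s = M.\<Gamma> \<xi> t s"
proof -
  let ?R = "resolvent_kernel K a \<xi>"
  have R: "continuous_on ({a..\<xi>} \<times> {a..\<xi>}) (\<lambda>(t, s). ?R t s)"
    "\<And>t. t \<in> {a..\<xi>} \<Longrightarrow> ?R t s - integral {a..\<xi>} (\<lambda>u. K t u ** ?R u s) = K t s"
    using resolvent_kernel_solves[OF \<xi>] s unfolding is_resolvent_kernel_def by blast+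
  have "?R t s = M.sol (\<lambda>t. clamp_kernel a b K t s) \<xi> t"
  proof (rule M.sol_unique[OF \<xi> _ _ t])
    show "continuous_on {a..\<xi>} (\<lambda>t. ?R t s)"
      using s by (intro continuous_on_compose2[OF R(1), of _ "\<lambda>t. (t, s)", simplified] continuous_intros) auto
    fix t assume t: "t \<in> {a..\<xi>}"
    have "integral {a..\<xi>} (\<lambda>u. K t u ** ?R u s) = integral {a..\<xi>} (\<lambda>u. clamp_kernel a b K t u ** ?R u s)"
      using t \<xi> by (intro integral_cong) simp
    then show "?R t s - integral {a..\<xi>} (\<lambda>u. clamp_kernel a b K t u ** ?R u s) = clamp_kernel a b K t s"
      using R(2)[OF t] t s \<xi> by simp
  qed
  also have "\<dots> = M.\<Gamma> \<xi> t s"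
    using M.\<Gamma>_right[OF \<xi>, of t s] t \<xi> by (simp add: M.sol_def algebra_simps)
  finally show ?thesis .
qed

text \<open>The factor \<open>mat 1\<close> is written out to present \<open>M\<close> as a moment
  of \<open>star\<close>, which \<open>M.moment_has_vector_derivative\<close> can
  differentiate.\<close>

lemma M_fun_eq:
  assumes \<xi>: "\<xi> \<in> {a..b}"
  shows "M_fun K a \<xi> = integral {a..\<xi>} (\<lambda>s. M.star \<xi> s ** mat 1)"
proof -
  have "integral {a..\<xi>} (\<lambda>s. integral {a..\<xi>} (\<lambda>t. resolvent_kernel K a \<xi> t s)) =
      integral {a..\<xi>} (\<lambda>s. integral {a..\<xi>} (\<lambda>t. M.\<Gamma> \<xi> t s))"
    using \<xi> by (intro integral_cong) (simp add: resolvent_kernel_eq)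
  moreover have "integral {a..\<xi>} (\<lambda>s. M.star \<xi> s ** mat 1) =
      integral {a..\<xi>} (\<lambda>s. mat 1) + integral {a..\<xi>} (\<lambda>s. integral {a..\<xi>} (\<lambda>t. M.\<Gamma> \<xi> t s))"
    unfolding M.star_def matrix_mul_rid using \<xi>
    by (intro integral_add integrable_continuous_interval continuous_on_integral_variable_end[of _ a b])
      (auto simp: case_prod_unfold intro!: continuous_intros)
  ultimately show ?thesis using \<xi> by (simp add: M_fun_def)
qed

lemma M_fun_has_vector_derivative:
  assumes \<xi>: "\<xi> \<in> {a..b}"
  shows "(M_fun K a has_vector_derivative g_star_sol K a \<xi> \<xi> ** g_sol K a \<xi> \<xi>) (at \<xi> within {a..b})"
proof -
  have "((\<lambda>\<eta>. integral {a..\<eta>} (\<lambda>s. M.star \<eta> s ** mat 1)) has_vector_derivative M.star \<xi> \<xi> ** g \<xi> \<xi>)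
      (at \<xi> within {a..b})"
    by (rule M.moment_has_vector_derivative[OF \<xi>]) simp
  then have "(M_fun K a has_vector_derivative M.star \<xi> \<xi> ** g \<xi> \<xi>) (at \<xi> within {a..b})"
    by (rule has_vector_derivative_transform[OF \<xi>, rotated]) (rule M_fun_eq)
  then show ?thesis using \<xi> by (simp add: g_sol_eq g_star_sol_eq)
qed

lemma M_deriv_eq: "\<xi> \<in> {a..b} \<Longrightarrow> M_deriv K a b \<xi> = M.star \<xi> \<xi> ** g \<xi> \<xi>"
  unfolding M_deriv_def
  using vector_derivative_within_closed_interval[OF ab _ M_fun_has_vector_derivative, of \<xi>]
  by (simp add: g_sol_eq g_star_sol_eq)

lemma g_star_moment_has_vector_derivative:
  assumes \<xi>: "\<xi> \<in> {a..b}" and f: "continuous_on {a..b} f"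
  shows "(g_star_moment K a f has_vector_derivative M.star \<xi> \<xi> *v V.sol f \<xi> \<xi>) (at \<xi> within {a..b})"
proof (rule has_vector_derivative_transform[OF \<xi> _ V.moment_has_vector_derivative[OF \<xi> f]])
  fix \<eta> assume "\<eta> \<in> {a..b}"
  then show "g_star_moment K a f \<eta> = integral {a..\<eta>} (\<lambda>s. M.star \<eta> s *v f s)"
    unfolding g_star_moment_def by (intro integral_cong) (simp add: g_star_sol_eq)
qed

lemma unique_fredholm:
  assumes f: "continuous_on {a..b} f"
  shows "unique_solution_on {a..b} (fredholm_equation K a b f) (V.sol f b)"
proof -
  have clamp: "fredholm_equation K a b f h \<longleftrightarrow> continuous_on {a..b} h \<and>
    (\<forall>t\<in>{a..b}. h t - integral {a..b} (\<lambda>s. clamp_kernel a b K t s *v h s) = f t)" for h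
  proof -
    have "integral {a..b} (\<lambda>s. K t s *v h s) = integral {a..b} (\<lambda>s. clamp_kernel a b K t s *v h s)"
      if "t \<in> {a..b}" for t using that by (intro integral_cong) simp
    then show ?thesis by (simp add: fredholm_equation_def)
  qed
  have b: "b \<in> {a..b}" using ab by simp
  show ?thesis
    unfolding unique_solution_on_def clamp
  proof (intro conjI ballI allI impI)
    show "continuous_on {a..b} (V.sol f b)" using b f by (intro V.continuous_on_sol continuous_intros) auto
    show "V.sol f b t - integral {a..b} (\<lambda>s. clamp_kernel a b K t s *v V.sol f b s) = f t" if "t \<in> {a..b}" for t
      by (rule V.sol_equation[OF b f that])
    fix h t
    assume h: "continuous_on {a..b} h \<and> (\<forall>t\<in>{a..b}. h t - integral {a..b} (\<lambda>s. clamp_kernel a b K t s *v h s) = f t)"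
      and t: "t \<in> {a..b}"
    show "h t = V.sol f b t" by (rule V.sol_unique[OF b _ _ t]) (use h in auto)
  qed
qed

section \<open>The solution formula for a given right-hand side\<close>

context
  fixes f :: "real \<Rightarrow> complex^'n"
  assumes f: "continuous_on {a..b} f"
    and det: "\<forall>\<xi>\<in>{a..b}. det (g_star_sol K a \<xi> \<xi> ** g_sol K a \<xi> \<xi>) \<noteq> 0"
begin

lemma det_star_g: "\<xi> \<in> {a..b} \<Longrightarrow> det (M.star \<xi> \<xi> ** g \<xi> \<xi>) \<noteq> 0"
  using det by (simp add: g_sol_eq g_star_sol_eq)

text \<open>The derivative of \<open>M\<close> is \<open>star\<close> times \<open>g\<close>, that
  of the moment is \<open>star\<close> times \<open>sol f\<close>; the factor \<open>star\<close>
  cancels.\<close>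

lemma g_V_fun: "\<xi> \<in> {a..b} \<Longrightarrow> g \<xi> \<xi> *v V_fun K a b f \<xi> = V.sol f \<xi> \<xi>"
  unfolding V_fun_def
  by (simp add: M_deriv_eq matrix_inv_mult_left det_star_g
      vector_derivative_within_closed_interval[OF ab _ g_star_moment_has_vector_derivative[OF _ f]])

text \<open>By \<open>g_V_fun\<close>, \<open>V\<close> solves a linear system with continuous data
  and nonsingular matrix.\<close>

lemma continuous_on_V_fun: "continuous_on {a..b} (V_fun K a b f)"
proof (rule continuous_on_linear_system)
  show "continuous_on {a..b} (\<lambda>\<xi>. g \<xi> \<xi>)" by (intro M.continuous_on_sol continuous_intros) auto
  show "det (g \<xi> \<xi>) \<noteq> 0" if "\<xi> \<in> {a..b}" for \<xi>
    using det_star_g[OF that] by (auto simp: det_mul)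
  have "continuous_on {a..b} (\<lambda>\<xi>. V.sol f \<xi> \<xi>)" by (intro V.continuous_on_sol f continuous_intros) auto
  then show "continuous_on {a..b} (\<lambda>\<xi>. g \<xi> \<xi> *v V_fun K a b f \<xi>)"
    by (rule continuous_on_eq) (simp add: g_V_fun)
qed

context
  fixes t
  assumes t: "t \<in> {a..b}"
begin

definition G' :: "real \<Rightarrow> complex^'n^'n" where "G' \<xi> = M.\<Gamma> \<xi> t \<xi> ** g \<xi> \<xi>"

lemma within_tail: "{t..b} \<subseteq> {a..b}" using t by auto

text \<open>Confined to \<open>[t,b]\<close> because the equation determines
  \<open>g_sol K a t \<xi>\<close> only for \<open>t \<le> \<xi>\<close>.\<close>

lemma g_sol_has_vector_derivative:
  assumes \<xi>: "\<xi> \<in> {t..b}"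
  shows "(g_sol K a t has_vector_derivative G' \<xi>) (at \<xi> within {t..b})"
proof (rule has_vector_derivative_transform[OF \<xi>])
  show "((\<lambda>\<xi>. g \<xi> t) has_vector_derivative G' \<xi>) (at \<xi> within {t..b})"
    unfolding G'_def using \<xi> t
    by (intro has_vector_derivative_within_subset[OF M.sol_has_vector_derivative within_tail]) auto
  show "g_sol K a t \<eta> = g \<eta> t" if "\<eta> \<in> {t..b}" for \<eta> using that t by (simp add: g_sol_eq)
qed

lemma continuous_on_G': "continuous_on {t..b} G'"
  unfolding G'_def
  by (intro M.comp.continuous_on M.continuous_on_\<Gamma> M.continuous_on_sol continuous_intros) (use t in auto)

text \<open>The derivatives of \<open>g\<close> and \<open>sol f\<close> share the factor
  \<open>\<Gamma> \<xi> t \<xi>\<close>, and \<open>g_V_fun\<close> relates the remaining diagonal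
  values. So \<open>sol f\<close> is the primitive \<open>W\<close> for integration by
  parts.\<close>

lemma sol_has_vector_derivative_V_fun:
  assumes \<xi>: "\<xi> \<in> {t..b}"
  shows "((\<lambda>\<xi>. V.sol f \<xi> t) has_vector_derivative G' \<xi> *v V_fun K a b f \<xi>) (at \<xi> within {t..b})"
proof -
  have \<xi>': "\<xi> \<in> {a..b}" using \<xi> t by auto
  have "G' \<xi> *v V_fun K a b f \<xi> = M.\<Gamma> \<xi> t \<xi> *v V.sol f \<xi> \<xi>"
    by (simp add: G'_def g_V_fun[OF \<xi>'] flip: matrix_vector_mul_assoc)
  then show ?thesis
    using has_vector_derivative_within_subset[OF V.sol_has_vector_derivative[OF \<xi>' f t] within_tail] by simp
qed

text \<open>After integration by parts the terms at the lower end point cancel, since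
  \<open>g(t,t) V(t)\<close> equals \<open>sol f t t\<close>.\<close>

lemma stieltjes_formula:
  "has_stieltjes_integral (g_sol K a t) (V_fun K a b f) (g_sol K a t b *v V_fun K a b f b - V.sol f b t) t b"
proof -
  have "has_stieltjes_integral (g_sol K a t) (V_fun K a b f)
      (g_sol K a t b *v V_fun K a b f b - g_sol K a t t *v V_fun K a b f t - (V.sol f b t - V.sol f t t)) t b"
    using t by (intro has_stieltjes_integral_by_parts[where G' = G'] g_sol_has_vector_derivative continuous_on_G'
        sol_has_vector_derivative_V_fun continuous_on_subset[OF continuous_on_V_fun within_tail]) auto
  then show ?thesis using t by (simp add: g_sol_eq g_V_fun)
qed

text \<open>For the gauge integral, integrability is part of the conclusion: integration by parts
  obtains it from that of \<open>G' V\<close>, whose integral is an increment of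
  \<open>sol f\<close> by the fundamental theorem.\<close>

lemma integral_formula:
  assumes diff: "\<forall>\<xi>\<in>{t<..<b}. V_fun K a b f differentiable (at \<xi> within {a..b})"
  shows "((\<lambda>\<xi>. g_sol K a t \<xi> *v vector_derivative (V_fun K a b f) (at \<xi> within {a..b})) has_integral
    (g_sol K a t b *v V_fun K a b f b - V.sol f b t)) {t..b}"
\<comment> \<open>The flip puts \<open>V\<close> first, as the rule concludes about the derivative
  of the first factor.\<close>
proof (rule integration_by_parts_interior[OF bounded_bilinear.flip[OF bounded_bilinear_matrix_vector_mult]])
  show "t \<le> b" using t by simp
  show "continuous_on {t..b} (V_fun K a b f)"
    by (rule continuous_on_subset[OF continuous_on_V_fun within_tail])
  show "continuous_on {t..b} (g_sol K a t)"
    using g_sol_has_vector_derivative by (rule continuous_on_vector_derivative)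
  show "(V_fun K a b f has_vector_derivative vector_derivative (V_fun K a b f) (at \<xi> within {a..b})) (at \<xi>)"
    if "\<xi> \<in> {t<..<b}" for \<xi>
    using diff that t vector_derivative_works[of "V_fun K a b f" "at \<xi> within {a..b}"]
    by (auto simp: at_within_Icc_at)
  show "(g_sol K a t has_vector_derivative G' \<xi>) (at \<xi>)" if "\<xi> \<in> {t<..<b}" for \<xi>
    using g_sol_has_vector_derivative[of \<xi>] that by (auto simp: at_within_Icc_at)
  have "((\<lambda>\<xi>. G' \<xi> *v V_fun K a b f \<xi>) has_integral V.sol f b t - V.sol f t t) {t..b}"
    using t by (intro fundamental_theorem_of_calculus sol_has_vector_derivative_V_fun) auto
  then show "((\<lambda>\<xi>. G' \<xi> *v V_fun K a b f \<xi>) has_integral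
      (g_sol K a t b *v V_fun K a b f b - g_sol K a t t *v V_fun K a b f t -
        (g_sol K a t b *v V_fun K a b f b - V.sol f b t))) {t..b}"
    using t by (simp add: g_sol_eq g_V_fun)
qed

end
end
end

theorem theorem3p1:
  fixes a b :: real
    and K :: "real \<Rightarrow> real \<Rightarrow> complex^'n^'n"
  assumes "a < b"
    and "continuous_on ({a..b} \<times> {a..b}) (\<lambda>(t, s). K t s)"
    and "\<forall>\<xi>\<in>{a<..b}. \<exists>h. unique_solution_on {a..\<xi>} (g_equation K a \<xi>) h"
    and "\<forall>\<xi>\<in>{a..b}. det (g_star_sol K a \<xi> \<xi> ** g_sol K a \<xi> \<xi>) \<noteq> 0"
  shows "(\<forall>\<xi>\<in>{a<..b}.
            unique_solution_on {a..\<xi>} (g_equation K a \<xi>) (\<lambda>t. g_sol K a t \<xi>) \<and>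
            unique_solution_on {a..\<xi>} (g_star_equation K a \<xi>) (\<lambda>t. g_star_sol K a t \<xi>) \<and>
            is_resolvent_kernel K a \<xi> (resolvent_kernel K a \<xi>)) \<and>
         (\<forall>\<xi>\<in>{a..b}. (M_fun K a has_vector_derivative
            g_star_sol K a \<xi> \<xi> ** g_sol K a \<xi> \<xi>) (at \<xi> within {a..b})) \<and>
         (\<forall>f :: real \<Rightarrow> complex^'n. continuous_on {a..b} f \<longrightarrow>
            (\<forall>\<xi>\<in>{a..b}. g_star_moment K a f differentiable (at \<xi> within {a..b})) \<and>
            (\<exists>\<phi>. unique_solution_on {a..b} (fredholm_equation K a b f) \<phi> \<and>
               (\<forall>t\<in>{a..b}.
                  (\<exists>I. has_stieltjes_integral (g_sol K a t) (V_fun K a b f) I t b \<and>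
                       \<phi> t = g_sol K a t b *v (matrix_inv (M_deriv K a b b) *v
                                vector_derivative (g_star_moment K a f) (at b within {a..b})) - I) \<and>
                  ((\<forall>\<xi>\<in>{t<..<b}. V_fun K a b f differentiable (at \<xi> within {a..b})) \<longrightarrow>
                     (\<lambda>\<xi>. g_sol K a t \<xi> *v vector_derivative (V_fun K a b f) (at \<xi> within {a..b}))
                        integrable_on {t..b} \<and>
                     \<phi> t = g_sol K a t b *v (matrix_inv (M_deriv K a b b) *v
                              vector_derivative (g_star_moment K a f) (at b within {a..b}))
                         - integral {t..b} (\<lambda>\<xi>. g_sol K a t \<xi> *v
                              vector_derivative (V_fun K a b f) (at \<xi> within {a..b}))))))"
proof -
  interpret matrix_fredholm a b K by (rule matrix_fredholm.intro) fact+
  have diff: "g_star_moment K a f differentiable (at \<xi> within {a..b})"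
    if "continuous_on {a..b} f" "\<xi> \<in> {a..b}" for f \<xi>
    using g_star_moment_has_vector_derivative[OF that(2,1)] by (rule differentiableI_vector)
  have formula: "\<exists>\<phi>. unique_solution_on {a..b} (fredholm_equation K a b f) \<phi> \<and>
      (\<forall>t\<in>{a..b}. (\<exists>I. has_stieltjes_integral (g_sol K a t) (V_fun K a b f) I t b \<and>
          \<phi> t = g_sol K a t b *v V_fun K a b f b - I) \<and>
        ((\<forall>\<xi>\<in>{t<..<b}. V_fun K a b f differentiable (at \<xi> within {a..b})) \<longrightarrow>
          (\<lambda>\<xi>. g_sol K a t \<xi> *v vector_derivative (V_fun K a b f) (at \<xi> within {a..b})) integrable_on {t..b} \<and>
          \<phi> t = g_sol K a t b *v V_fun K a b f b - integral {t..b} (\<lambda>\<xi>. g_sol K a t \<xi> *v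
            vector_derivative (V_fun K a b f) (at \<xi> within {a..b}))))"
    if f: "continuous_on {a..b} f" for f
  proof (intro exI conjI ballI impI)
    show "unique_solution_on {a..b} (fredholm_equation K a b f) (V.sol f b)" by (rule unique_fredholm[OF f])
    fix t assume t: "t \<in> {a..b}"
    show "has_stieltjes_integral (g_sol K a t) (V_fun K a b f) (g_sol K a t b *v V_fun K a b f b - V.sol f b t) t b"
      by (rule stieltjes_formula[OF f assms(4) t])
    show "V.sol f b t = g_sol K a t b *v V_fun K a b f b - (g_sol K a t b *v V_fun K a b f b - V.sol f b t)"
      by simp
    assume "\<forall>\<xi>\<in>{t<..<b}. V_fun K a b f differentiable (at \<xi> within {a..b})"
    from integral_formula[OF f assms(4) t this]
    show "(\<lambda>\<xi>. g_sol K a t \<xi> *v vector_derivative (V_fun K a b f) (at \<xi> within {a..b})) integrable_on {t..b}"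
      "V.sol f b t = g_sol K a t b *v V_fun K a b f b - integral {t..b} (\<lambda>\<xi>. g_sol K a t \<xi> *v
            vector_derivative (V_fun K a b f) (at \<xi> within {a..b}))"
      by (auto simp: integral_unique has_integral_integrable)
  qed
  show ?thesis
    \<comment> \<open>Unfolding \<open>V_fun\<close> at \<open>b\<close> alone expands the boundary
      term and keeps the integrator folded.\<close>
    using formula unfolding V_fun_def[of K a b _ b]
    by (intro conjI ballI allI impI unique_g unique_g_star resolvent_kernel_solves M_fun_has_vector_derivative diff)
      auto
qed

end
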